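(* Let $\eta$ be a non-periodic Toeplitz sequence with period structure $(p_n)_{n\ge1}$. Assume that for every $n\in\mathbb N$ there is a primitive set $A_n$ of positive integers and, for each $a\in A_n$, a set $S_n(a)$ of positive integers such that $$\widetilde{\mathcal H}_n=\bigcup_{a\in A_n}\bigl(a\mathbb Z\setminus\mathcal M_{S_n(a)}\bigr)\quad\text{and}\quad a\mathbb Z\setminus\mathcal M_{S_n(a)}\ne\emptyset\ \ (a\in A_n).$$ If for all choices of $a_n\in A_n$ ($n\in\mathbb N$) $$\lim_{n\to\infty}\ \sum_{a'\in A_n\setminus\{a_n\}}\frac1{\varphi\bigl(a'/\gcd(a',a_n)\bigr)}=0,$$ then for all $k\in\mathbb Z\setminus\{0\}$ and all $\beta\in G$ the set $\partial W\cap(\partial W-\beta)\cap(\partial W-2\beta-\Delta(k))$ is nowhere dense with respect to the subspace topology of $\partial W$; a fortiori, $\partial W\cap(\partial W-\Delta(k))$ is nowhere dense in $\partial W$ for all $k\in\mathbb Z\setminus\{0\}$. Moreover, if the automorphism $F$ of $(X_\eta,\sigma)$ is described by a block code $\{0,1\}^{[-m:m]}\to\{0,1\}$, then $K\subseteq[-m,m]$, $\operatorname{int}_{\partial W}(V_{k_i})\cap\operatorname{int}_{\partial W}(V_{k_j})=\emptyset$ for any different $k_i,k_j\in K$, $\partial W=\bigcup_{k\in K}V_k'$ where $V_k'=\overline{\operatorname{int}_{\partial W}(V_k)}$, and $$V_k'+(y_F-\Delta(k))\mathbb Z\subseteq V_k'\quad\text{for all }k\in K.$$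
   Context: $\mathbb N=\{1,2,\dots\}$; $\varphi$ is Euler's totient function. For a set $A$ of positive integers, $\mathcal M_A=\bigcup_{a\in A}a\mathbb Z$; $A$ is primitive if no element divides a different element. A non-periodic Toeplitz sequence with period structure $p_1\mid p_2\mid\dots\to\infty$ is a non-periodic $\eta\in\{0,1\}^{\mathbb Z}$ such that for each $k\in\mathbb Z$ there is $n\ge1$ with $\eta|_{k+p_n\mathbb Z}$ constant. $\sigma$ is the left shift and $X_\eta$ the orbit closure of $\eta$. For $i=0,1$: $\mathcal P_n^i=\{k\in\mathbb Z:\eta|_{k+p_n\mathbb Z}=i\}$; $\mathcal H_n=\mathbb Z\setminus(\mathcal P_n^0\cup\mathcal P_n^1)$ (holes at level $n$); essential holes: $\widetilde{\mathcal H}_N=\{k\in\mathcal H_N:\mathcal H_n\cap(k+p_N\mathbb Z)\neq\emptyset\ \forall n\ge N\}$. $G=\varprojlim\mathbb Z/p_n\mathbb Z$; $\Delta(k)=(k+p_n\mathbb Z)_n$; $Tg=g+\Delta(1)$; $U_n(h)=\{g\in G:g_n=h_n\}$; $V^i=\bigcup_{n}\bigcup_{k\in\mathcal P_n^i\cap[0,p_n)}U_n(\Delta(k))$; $W=\overline{V^1}=G\setminus V^0$ with boundary $\partial W=G\setminus(V^0\cup V^1)$. Standing assumption: $(G,T)$ is the maximal equicontinuous factor of $(X_\eta,\sigma)$, with factor map $\pi$ determined by $\pi(\eta)=\Delta(0)$. An automorphism is a homeomorphism $F$ of $X_\eta$ commuting with $\sigma$; $y_F\in G$ is the unique element with $\pi(F(x))=\pi(x)+y_F$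 for all $x\in X_\eta$. $F$ is described by a block code $c:\{0,1\}^{[-m:m]}\to\{0,1\}$ if $(Fx)_s=c(x_{s-m},\dots,x_{s+m})$ for all $x\in X_\eta$, $s\in\mathbb Z$. For $k\in\mathbb Z$: $V_k=\partial W\cap(\partial W+\Delta(k)-y_F)$; $\operatorname{int}_{\partial W}$ is the interior in the subspace topology of $\partial W$; $K=\{k\in\mathbb Z:\operatorname{int}_{\partial W}(V_k)\neq\emptyset\}$. For $\gamma\in G$, $\gamma\mathbb Z=\{j\gamma:j\in\mathbb Z\}$. *)

theory Defs
  imports "HOL-Analysis.Analysis" "HOL-Number_Theory.Totient"
begin

(* Elements of {0,1}^Z have type int => bool (False = 0, True = 1), with the product of the
   discrete topologies.  All sequences (p_n), (A_n), ... indexed by {1,2,...} are indexed by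
   nat = {0,1,...} here, i.e. p n stands for p_{n+1}. *)


section \<open>Toeplitz sequences\<close>

definition coset :: "int \<Rightarrow> nat \<Rightarrow> int set" where
  "coset k q = {k + int q * j |j. True}"

definition period_structure :: "(nat \<Rightarrow> nat) \<Rightarrow> bool" where
  "period_structure p \<longleftrightarrow> (\<forall>n. p n > 0) \<and> (\<forall>n. p n dvd p (Suc n)) \<and> filterlim p at_top sequentially"

definition periodic_seq :: "(int \<Rightarrow> bool) \<Rightarrow> bool" where
  "periodic_seq \<eta> \<longleftrightarrow> (\<exists>q>0. \<forall>k. \<eta> (k + q) = \<eta> k)"

definition nonperiodic_toeplitz :: "(nat \<Rightarrow> nat) \<Rightarrow> (int \<Rightarrow> bool) \<Rightarrow> bool" where
  "nonperiodic_toeplitz p \<eta> \<longleftrightarrow>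
     period_structure p \<and> \<not> periodic_seq \<eta> \<and> (\<forall>k. \<exists>n. \<eta> constant_on coset k (p n))"

definition shift :: "(int \<Rightarrow> bool) \<Rightarrow> int \<Rightarrow> bool" where
  "shift x = (\<lambda>i. x (i + 1))"

definition orbit_closure :: "(int \<Rightarrow> bool) \<Rightarrow> (int \<Rightarrow> bool) set" where
  "orbit_closure \<eta> = closure {\<lambda>i. \<eta> (i + k) |k. True}"

definition Per :: "(nat \<Rightarrow> nat) \<Rightarrow> (int \<Rightarrow> bool) \<Rightarrow> nat \<Rightarrow> bool \<Rightarrow> int set" where
  "Per p \<eta> n i = {k. \<forall>l\<in>coset k (p n). \<eta> l = i}"

definition holes :: "(nat \<Rightarrow> nat) \<Rightarrow> (int \<Rightarrow> bool) \<Rightarrow> nat \<Rightarrow> int set" where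
  "holes p \<eta> n = UNIV - (Per p \<eta> n False \<union> Per p \<eta> n True)"

definition essential_holes :: "(nat \<Rightarrow> nat) \<Rightarrow> (int \<Rightarrow> bool) \<Rightarrow> nat \<Rightarrow> int set" where
  "essential_holes p \<eta> N = {k \<in> holes p \<eta> N. \<forall>n\<ge>N. holes p \<eta> n \<inter> coset k (p N) \<noteq> {}}"


section \<open>Sets of multiples\<close>

definition multiples :: "nat set \<Rightarrow> int set" where
  "multiples A = (\<Union>a\<in>A. {int a * j |j. True})"

definition primitive :: "nat set \<Rightarrow> bool" where
  "primitive A \<longleftrightarrow> (\<forall>a\<in>A. \<forall>b\<in>A. a dvd b \<longrightarrow> a = b)"


section \<open>The odometer\<close>

(* The residue class g_n in Z/p_n Z is represented by its element in {0..<p_n}.  The topology of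
   nat => int is the product of the discrete ones. *)

definition odometer :: "(nat \<Rightarrow> nat) \<Rightarrow> (nat \<Rightarrow> int) set" where
  "odometer p = {g. \<forall>n. g n \<in> {0..<int (p n)} \<and> g (Suc n) mod int (p n) = g n}"

definition od_add :: "(nat \<Rightarrow> nat) \<Rightarrow> (nat \<Rightarrow> int) \<Rightarrow> (nat \<Rightarrow> int) \<Rightarrow> nat \<Rightarrow> int" where
  "od_add p g h = (\<lambda>n. (g n + h n) mod int (p n))"

definition od_diff :: "(nat \<Rightarrow> nat) \<Rightarrow> (nat \<Rightarrow> int) \<Rightarrow> (nat \<Rightarrow> int) \<Rightarrow> nat \<Rightarrow> int" where
  "od_diff p g h = (\<lambda>n. (g n - h n) mod int (p n))"

definition od_mult :: "(nat \<Rightarrow> nat) \<Rightarrow> int \<Rightarrow> (nat \<Rightarrow> int) \<Rightarrow> nat \<Rightarrow> int" where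
  "od_mult p j g = (\<lambda>n. (j * g n) mod int (p n))"

definition Delta :: "(nat \<Rightarrow> nat) \<Rightarrow> int \<Rightarrow> nat \<Rightarrow> int" where
  "Delta p k = (\<lambda>n. k mod int (p n))"

definition od_step :: "(nat \<Rightarrow> nat) \<Rightarrow> (nat \<Rightarrow> int) \<Rightarrow> nat \<Rightarrow> int" where
  "od_step p g = od_add p g (Delta p 1)"

definition od_cyl :: "(nat \<Rightarrow> nat) \<Rightarrow> nat \<Rightarrow> (nat \<Rightarrow> int) \<Rightarrow> (nat \<Rightarrow> int) set" where
  "od_cyl p n h = {g \<in> odometer p. g n = h n}"

definition V :: "(nat \<Rightarrow> nat) \<Rightarrow> (int \<Rightarrow> bool) \<Rightarrow> bool \<Rightarrow> (nat \<Rightarrow> int) set" where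
  "V p \<eta> i = (\<Union>n. \<Union>k \<in> Per p \<eta> n i \<inter> {0..<int (p n)}. od_cyl p n (Delta p k))"

definition W :: "(nat \<Rightarrow> nat) \<Rightarrow> (int \<Rightarrow> bool) \<Rightarrow> (nat \<Rightarrow> int) set" where
  "W p \<eta> = top_of_set (odometer p) closure_of V p \<eta> True"

definition bdW :: "(nat \<Rightarrow> nat) \<Rightarrow> (int \<Rightarrow> bool) \<Rightarrow> (nat \<Rightarrow> int) set" where
  "bdW p \<eta> = top_of_set (odometer p) frontier_of W p \<eta>"

lemma period_dvd:
  assumes "period_structure p" "n \<le> m"
  shows "p n dvd p m"
  using assms(2)
proof (induction rule: dec_induct)
  case (step k)
  have "p k dvd p (Suc k)" using assms(1) by (simp add: period_structure_def)
  with step.IH show ?case by (rule dvd_trans)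
qed simp

lemma odometer_mod:
  assumes "period_structure p" "g \<in> odometer p" "n \<le> m"
  shows "g m mod int (p n) = g n"
  using assms(3)
proof (induction rule: dec_induct)
  case base
  have "0 \<le> g n" "g n < int (p n)" using assms(2) unfolding odometer_def by simp_all
  then show ?case by (rule mod_pos_pos_trivial)
next
  case (step k)
  have "int (p n) dvd int (p k)" using period_dvd[OF assms(1) step(1)] by simp
  then have "g (Suc k) mod int (p k) mod int (p n) = g (Suc k) mod int (p n)"
    by (rule mod_mod_cancel)
  moreover have "g (Suc k) mod int (p k) = g k" using assms(2) unfolding odometer_def by blast
  ultimately show ?case using step.IH by metis
qed

lemma coset_iff: "l \<in> coset k q \<longleftrightarrow> l mod int q = k mod int q"
proof -
  have "l = k + int q * j \<longleftrightarrow> l - k = int q * j" for j by linarith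
  then show ?thesis by (simp add: coset_def mod_eq_dvd_iff dvd_def)
qed

lemma mem_V_iff: "g \<in> V p \<eta> i \<longleftrightarrow> g \<in> odometer p \<and> (\<exists>n. g n \<in> Per p \<eta> n i)"
proof -
  have "(\<exists>k \<in> Per p \<eta> n i \<inter> {0..<int (p n)}. g n = k mod int (p n)) \<longleftrightarrow> g n \<in> Per p \<eta> n i"
    if "g \<in> odometer p" for n
  proof
    assume "g n \<in> Per p \<eta> n i"
    moreover have "g n \<in> {0..<int (p n)}" using that unfolding odometer_def by blast
    ultimately show "\<exists>k \<in> Per p \<eta> n i \<inter> {0..<int (p n)}. g n = k mod int (p n)"
      by (intro bexI[of _ "g n"]) simp_all
  next
    assume "\<exists>k \<in> Per p \<eta> n i \<inter> {0..<int (p n)}. g n = k mod int (p n)"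
    then obtain k where "k \<in> Per p \<eta> n i" "k \<in> {0..<int (p n)}" "g n = k mod int (p n)" by blast
    then show "g n \<in> Per p \<eta> n i" by simp
  qed
  then show ?thesis unfolding V_def od_cyl_def Delta_def by blast
qed

lemma V_disjoint:
  assumes "period_structure p"
  shows "V p \<eta> False \<inter> V p \<eta> True = {}"
proof -
  have pos: "p n > 0" for n using assms by (auto simp: period_structure_def)
  have False if g: "g \<in> odometer p" and 0: "g n \<in> Per p \<eta> n False" and 1: "g m \<in> Per p \<eta> m True" for g n m
  proof (cases "n \<le> m")
    case True
    then have "g m \<in> coset (g n) (p n)" using odometer_mod[OF assms g True] pos by (simp add: coset_iff) (metis mod_mod_trivial)
    moreover have "g m \<in> coset (g m) (p m)" using pos by (simp add: coset_iff)
    ultimately show False using 0 1 by (auto simp: Per_def)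
  next
    case False
    then have "g n \<in> coset (g m) (p m)" using odometer_mod[OF assms g, of m n] pos by (simp add: coset_iff) (metis mod_mod_trivial)
    moreover have "g n \<in> coset (g n) (p n)" using pos by (simp add: coset_iff)
    ultimately show False using 0 1 by (auto simp: Per_def)
  qed
  then show ?thesis by (auto simp: mem_V_iff)
qed

lemma openin_V: "openin (top_of_set (odometer p)) (V p \<eta> i)"
  unfolding V_def
proof (intro openin_Union ballI; clarsimp?)
  have "openin (top_of_set (odometer p)) (od_cyl p n h)" for n h
  proof -
    have "open ((\<lambda>g :: nat \<Rightarrow> int. g n) -` {h n})"
      by (intro open_vimage continuous_on_product_coordinates open_discrete)
    moreover have "od_cyl p n h = odometer p \<inter> (\<lambda>g. g n) -` {h n}" by (auto simp: od_cyl_def)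
    ultimately show ?thesis by (metis openin_open_Int)
  qed
  then show "openin (top_of_set (odometer p)) (\<Union>k\<in>Per p \<eta> n i \<inter> {0..<int (p n)}. od_cyl p n (Delta p k))" for n
    by blast
qed

lemma od_cyl_nbhd:
  assumes "period_structure p" "h \<in> odometer p" "openin (top_of_set (odometer p)) U" "h \<in> U"
  shows "\<exists>n. od_cyl p n h \<subseteq> U"
proof -
  obtain O' where O': "open O'" "U = odometer p \<inter> O'" using assms(3) by (auto simp: openin_open)
  then obtain X where X: "h \<in> Pi\<^sub>E UNIV X" "finite {i. X i \<noteq> UNIV}" "Pi\<^sub>E UNIV X \<subseteq> O'"
    using product_topology_open_contains_basis[of "\<lambda>_. euclidean" UNIV O' h] assms(4)
    by (auto simp: open_fun_def)
  obtain n where n: "\<And>i. X i \<noteq> UNIV \<Longrightarrow> i \<le> n"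
    using X(2) finite_nat_set_iff_bounded_le by auto
  have "g \<in> U" if g: "g \<in> od_cyl p n h" for g
  proof -
    have "g i \<in> X i" for i
    proof (cases "i \<le> n")
      case True
      have "g \<in> odometer p" "g n = h n" using g by (auto simp: od_cyl_def)
      then have "g i = h i"
        using odometer_mod[OF assms(1) _ True, of g] odometer_mod[OF assms(1,2) True] by simp
      then show ?thesis using X(1) by auto
    qed (use n in auto)
    then show ?thesis using g O' X(3) by (auto simp: od_cyl_def)
  qed
  then show ?thesis by blast
qed

lemma closure_of_V:
  assumes "nonperiodic_toeplitz p \<eta>"
  shows "top_of_set (odometer p) closure_of V p \<eta> i = odometer p - V p \<eta> (\<not> i)"
proof -
  have ps: "period_structure p" using assms by (simp add: nonperiodic_toeplitz_def)
  have pos: "p n > 0" for n using ps by (auto simp: period_structure_def)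
  have disj: "V p \<eta> i \<inter> V p \<eta> (\<not> i) = {}" using V_disjoint[OF ps, of \<eta>] by (cases i) auto
  have sub: "V p \<eta> i \<subseteq> odometer p" using mem_V_iff by blast
  have dense: "\<exists>v. v \<in> V p \<eta> i \<and> v \<in> U"
    if h: "h \<in> odometer p" "h \<notin> V p \<eta> (\<not> i)" "h \<in> U" "openin (top_of_set (odometer p)) U" for h U
  proof -
    obtain n where n: "od_cyl p n h \<subseteq> U" using od_cyl_nbhd[OF ps] h by blast
    have "h n \<notin> Per p \<eta> n (\<not> i)" using h mem_V_iff by blast
    then obtain l where l: "l \<in> coset (h n) (p n)" "\<eta> l = i" by (auto simp: Per_def)
    obtain m where m: "\<eta> constant_on coset l (p m)"
      using assms unfolding nonperiodic_toeplitz_def by blast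
    have D: "Delta p l \<in> odometer p"
      using pos ps by (auto simp: odometer_def Delta_def period_structure_def mod_mod_cancel)
    have "l \<in> coset l (p m)" using pos by (simp add: coset_iff)
    then have "\<forall>l'\<in>coset l (p m). \<eta> l' = i" using m l(2) unfolding constant_on_def by metis
    then have "Delta p l m \<in> Per p \<eta> m i" using pos by (auto simp: Per_def Delta_def coset_iff)
    then have "Delta p l \<in> V p \<eta> i" using D mem_V_iff by blast
    moreover have "Delta p l n = h n"
      using l(1) pos h(1) by (auto simp: coset_iff Delta_def odometer_def)
    then have "Delta p l \<in> U" using n D by (auto simp: od_cyl_def)
    ultimately show ?thesis by blast
  qed
  have "h \<notin> top_of_set (odometer p) closure_of V p \<eta> i" if "h \<in> V p \<eta> (\<not> i)" for h
    using openin_V[of p \<eta> "\<not> i"] disj that unfolding in_closure_of by blast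
  then have "top_of_set (odometer p) closure_of V p \<eta> i \<subseteq> odometer p - V p \<eta> (\<not> i)"
    using closure_of_subset_topspace[of "top_of_set (odometer p)"] by auto
  moreover have "h \<in> top_of_set (odometer p) closure_of V p \<eta> i"
    if "h \<in> odometer p" "h \<notin> V p \<eta> (\<not> i)" for h
    unfolding in_closure_of using dense[OF that] that(1) by simp
  ultimately show ?thesis by blast
qed

lemma W_eq:
  assumes "nonperiodic_toeplitz p \<eta>"
  shows "W p \<eta> = odometer p - V p \<eta> False"
  using closure_of_V[OF assms, of True] by (simp add: W_def)

lemma bdW_eq:
  assumes "nonperiodic_toeplitz p \<eta>"
  shows "bdW p \<eta> = odometer p - (V p \<eta> False \<union> V p \<eta> True)"
proof -
  have ps: "period_structure p" using assms by (simp add: nonperiodic_toeplitz_def)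
  have sub: "V p \<eta> i \<subseteq> odometer p" for i using mem_V_iff by blast
  have "closedin (top_of_set (odometer p)) (odometer p - V p \<eta> False)"
    using openin_V by (simp add: closedin_diff)
  moreover have "odometer p - (odometer p - V p \<eta> False) = V p \<eta> False"
    using sub by blast
  ultimately show ?thesis
    using closure_of_V[OF assms, of False]
    unfolding bdW_def frontier_of_closures W_eq[OF assms]
    by (simp add: closure_of_closedin) blast
qed

definition nowhere_dense_in :: "'a topology \<Rightarrow> 'a set \<Rightarrow> bool" where
  "nowhere_dense_in X A \<longleftrightarrow> A \<subseteq> topspace X \<and> X interior_of (X closure_of A) = {}"


section \<open>Maximal equicontinuous factors\<close>

definition dyn_system :: "'a topology \<Rightarrow> ('a \<Rightarrow> 'a) \<Rightarrow> bool" where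
  "dyn_system Y S \<longleftrightarrow> compact_space Y \<and> metrizable_space Y \<and> homeomorphic_map Y Y S"

(* Equicontinuity of {S^n | n in Z}; by compactness the choice of the metric d is irrelevant. *)
definition equicontinuous_system :: "'a topology \<Rightarrow> ('a \<Rightarrow> 'a) \<Rightarrow> bool" where
  "equicontinuous_system Y S \<longleftrightarrow> dyn_system Y S \<and>
     (\<exists>d. Metric_space (topspace Y) d \<and> Metric_space.mtopology (topspace Y) d = Y \<and>
       (\<forall>\<epsilon>>0. \<exists>\<delta>>0. \<forall>x\<in>topspace Y. \<forall>y\<in>topspace Y. d x y < \<delta> \<longrightarrow>
         (\<forall>n. d ((S ^^ n) x) ((S ^^ n) y) < \<epsilon> \<and>
              d ((inv_into (topspace Y) S ^^ n) x) ((inv_into (topspace Y) S ^^ n) y) < \<epsilon>)))"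

definition factor_map ::
  "'a topology \<Rightarrow> ('a \<Rightarrow> 'a) \<Rightarrow> 'b topology \<Rightarrow> ('b \<Rightarrow> 'b) \<Rightarrow> ('a \<Rightarrow> 'b) \<Rightarrow> bool" where
  "factor_map X R Y S \<phi> \<longleftrightarrow> continuous_map X Y \<phi> \<and> \<phi> ` topspace X = topspace Y \<and>
     (\<forall>x\<in>topspace X. \<phi> (R x) = S (\<phi> x))"

(* The competing factors Y live on the same type as the odometer.  This is no restriction: a factor
   of a subshift has at most continuum many points, so it has an isomorphic copy whose carrier is a
   subset of nat => int (with an arbitrary topology, unrelated to the product topology). *)
definition max_equicontinuous_factor ::
  "(int \<Rightarrow> bool) topology \<Rightarrow> ((int \<Rightarrow> bool) \<Rightarrow> int \<Rightarrow> bool) \<Rightarrow>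
   (nat \<Rightarrow> int) topology \<Rightarrow> ((nat \<Rightarrow> int) \<Rightarrow> nat \<Rightarrow> int) \<Rightarrow> ((int \<Rightarrow> bool) \<Rightarrow> nat \<Rightarrow> int) \<Rightarrow> bool" where
  "max_equicontinuous_factor X R G T \<pi> \<longleftrightarrow>
     equicontinuous_system G T \<and> factor_map X R G T \<pi> \<and>
     (\<forall>(Y :: (nat \<Rightarrow> int) topology) S \<phi>.
        equicontinuous_system Y S \<and> factor_map X R Y S \<phi> \<longrightarrow>
        (\<exists>\<psi>. factor_map G T Y S \<psi> \<and> (\<forall>x\<in>topspace X. \<phi> x = \<psi> (\<pi> x))))"


section \<open>Automorphisms\<close>

definition automorphism :: "(int \<Rightarrow> bool) set \<Rightarrow> ((int \<Rightarrow> bool) \<Rightarrow> int \<Rightarrow> bool) \<Rightarrow> bool" where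
  "automorphism X F \<longleftrightarrow> homeomorphic_map (top_of_set X) (top_of_set X) F \<and>
     (\<forall>x\<in>X. F (shift x) = shift (F x))"

(* Only the values of c on lists of length 2m+1 matter. *)
definition described_by ::
  "(int \<Rightarrow> bool) set \<Rightarrow> ((int \<Rightarrow> bool) \<Rightarrow> int \<Rightarrow> bool) \<Rightarrow> nat \<Rightarrow> (bool list \<Rightarrow> bool) \<Rightarrow> bool" where
  "described_by X F m c \<longleftrightarrow> (\<forall>x\<in>X. \<forall>s. F x s = c (map x [s - int m..s + int m]))"

definition y_of ::
  "(nat \<Rightarrow> nat) \<Rightarrow> (int \<Rightarrow> bool) set \<Rightarrow> ((int \<Rightarrow> bool) \<Rightarrow> nat \<Rightarrow> int) \<Rightarrow>
   ((int \<Rightarrow> bool) \<Rightarrow> int \<Rightarrow> bool) \<Rightarrow> nat \<Rightarrow> int" where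
  "y_of p X \<pi> F = (THE y. y \<in> odometer p \<and> (\<forall>x\<in>X. \<pi> (F x) = od_add p (\<pi> x) y))"

(* In the following three definitions y stands for y_F. *)

definition V_at :: "(nat \<Rightarrow> nat) \<Rightarrow> (int \<Rightarrow> bool) \<Rightarrow> (nat \<Rightarrow> int) \<Rightarrow> int \<Rightarrow> (nat \<Rightarrow> int) set" where
  "V_at p \<eta> y k = bdW p \<eta> \<inter> (\<lambda>g. od_diff p (od_add p g (Delta p k)) y) ` bdW p \<eta>"

definition int_V_at :: "(nat \<Rightarrow> nat) \<Rightarrow> (int \<Rightarrow> bool) \<Rightarrow> (nat \<Rightarrow> int) \<Rightarrow> int \<Rightarrow> (nat \<Rightarrow> int) set" where
  "int_V_at p \<eta> y k = top_of_set (bdW p \<eta>) interior_of V_at p \<eta> y k"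

definition K_set :: "(nat \<Rightarrow> nat) \<Rightarrow> (int \<Rightarrow> bool) \<Rightarrow> (nat \<Rightarrow> int) \<Rightarrow> int set" where
  "K_set p \<eta> y = {k. int_V_at p \<eta> y k \<noteq> {}}"

definition V'_at :: "(nat \<Rightarrow> nat) \<Rightarrow> (int \<Rightarrow> bool) \<Rightarrow> (nat \<Rightarrow> int) \<Rightarrow> int \<Rightarrow> (nat \<Rightarrow> int) set" where
  "V'_at p \<eta> y k = top_of_set (odometer p) closure_of int_V_at p \<eta> y k"

end

theory Submission
  imports Defs
begin

text \<open>
  At level $n$ the boundary of $W$ projects onto the essential holes. If a relatively open piece of
  the boundary were carried into the boundary by $\beta$ and by $2\beta + \Delta(k)$, then for large $n$ the
  summability condition yields a generator $a \in A_n$ dividing both $\beta_n$ and $2\beta_n + k$, hence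
  $k$. As $a$ is itself a hole at level $n$ and every integer eventually stops being a hole, $k = 0$.

  For an automorphism $F$ with a code of radius $m$, two points over the same boundary point that
  differ at $0$ have preimages that differ somewhere in $[-m, m]$; so finitely many translates of the
  boundary by $y_F - \Delta(s)$, $|s| \le m$, cover it: every boundary point is moved into the boundary
  by some $-y_F + \Delta(s)$. Given such a finite family of translations $\delta + \Delta(l)$, the first
  part forces a point that stays in the boundary, together with its neighbours, under
  $\delta + \Delta(k)$ to be moved on by the same translation, so the closed pieces are invariant.
  Applied to $-y_F$, this gives a finite cover for $y_F$ with the same radius, to which the argument
  applies again.
\<close>

section \<open>Totatives in residue classes\<close>

text \<open>The totient enters because multiplication by a number prime to p_n keeps an essential
  hole an essential hole, once all generators divide p_n. One hole c thus yields the holes c w with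
  w a totative of p_n, and if c w + b is to be divisible by a foreign generator a', then w is
  confined to one class modulo a'/gcd(a', c), which contains at most a fraction 1/\<phi>(a'/gcd(a',
  c)) of the totatives. Passing from gcd(a', c) to gcd(a', a) costs a factor Q = p_N, where N is the
  level of the given cylinder, and so does the restriction to w in the class of 1 modulo Q. Since N
  is fixed before n, the sums drop below 1/(4 Q^2) for all large n. The limit hypothesis treats one
  choice of generators at a time, so a worst choice at each level is needed to make the bound
  uniform.\<close>

text \<open>Every prime factor q of \<open>P\<close> divides exactly one of u and v t, hence not the
  sum: if q divides u, it divides neither t nor, by coprimality, v; otherwise it divides t.\<close>

lemma exists_coprime_in_class:
  fixes u v P :: nat
  assumes "coprime u v" "P > 0"
  obtains w where "[w = u] (mod v)" "coprime w P"
proof -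
  define t where "t = \<Prod>{q \<in> prime_factors P. \<not> q dvd u}"
  have "\<not> q dvd u + v * t" if q: "prime q" "q dvd P" for q
  proof
    assume d: "q dvd u + v * t"
    have t: "q dvd t \<longleftrightarrow> \<not> q dvd u"
    proof -
      have "q dvd t \<longleftrightarrow> (\<exists>r\<in>{q \<in> prime_factors P. \<not> q dvd u}. q dvd r)"
        unfolding t_def using q(1) by (simp add: prime_dvd_prod_iff)
      also have "\<dots> \<longleftrightarrow> \<not> q dvd u"
        using q assms(2) by (auto simp: in_prime_factors_iff dest: primes_dvd_imp_eq)
      finally show ?thesis .
    qed
    show False
    proof (cases "q dvd u")
      case True
      with d have "q dvd v * t" using dvd_add_right_iff by blast
      with q(1) have "q dvd v \<or> q dvd t" by (simp add: prime_dvd_mult_iff)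
      with t True assms(1) q(1) show False
        using coprime_common_divisor not_prime_unit by blast
    next
      case False
      then show False using d t by (metis dvd_add_left_iff dvd_mult)
    qed
  qed
  then have "coprime (u + v * t) P"
    using prime_factor_nat[of "gcd (u + v * t) P"] by (auto simp: coprime_iff_gcd_eq_1)
  then show ?thesis using that[of "u + v * t"] by (simp add: cong_def)
qed

text \<open>Multiplication by a unit \<open>w0\<close> modulo \<open>P\<close> that lifts r'/r
  modulo m carries the first class injectively into the second.\<close>

lemma card_totatives_cong_mono:
  fixes P m r r' :: nat
  assumes "m dvd P" "P > 0" "coprime r m" "coprime r' m"
  shows "card {w \<in> totatives P. [w = r] (mod m)} \<le> card {w \<in> totatives P. [w = r'] (mod m)}"
\<comment> \<open>For \<open>P\<close> = 1 the reduced product is 0, whereas the only totative is 1,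
  so the map \<open>?f\<close> below does not apply.\<close>
proof (cases "P = 1")
  case True
  with assms(1) show ?thesis by simp
next
  case False
  with assms(2) have P: "P > 1" by simp
  obtain r1 where r1: "[r * r1 = 1] (mod m)" using assms(3) cong_solve_coprime_nat[of r m] by auto
  then have "coprime (r1 * r') m"
    using assms(4) by (metis cong_imp_coprime cong_sym coprime_1_left coprime_mult_left_iff)
  then obtain w0 where w0: "[w0 = r1 * r'] (mod m)" "coprime w0 P"
    using exists_coprime_in_class assms(2) by metis
  have rw0: "[r * w0 = r'] (mod m)"
  proof -
    have "[r * w0 = r * r1 * r'] (mod m)" using w0(1) by (simp add: cong_scalar_left mult.assoc)
    also have "[r * r1 * r' = 1 * r'] (mod m)" using r1 by (rule cong_scalar_right)
    finally show ?thesis by simp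
  qed
  let ?f = "\<lambda>w. w * w0 mod P"
  show ?thesis
  proof (rule card_inj_on_le)
    show "inj_on ?f {w \<in> totatives P. [w = r] (mod m)}"
    proof (rule inj_onI)
      fix x y assume xy: "x \<in> {w \<in> totatives P. [w = r] (mod m)}" "y \<in> {w \<in> totatives P. [w = r] (mod m)}"
        "x * w0 mod P = y * w0 mod P"
      then have "[x = y] (mod P)" using w0(2) cong_mult_rcancel_nat[of w0 P x y] by (simp add: cong_def)
      then show "x = y" using xy P totatives_less[of _ P] by (simp add: cong_def)
    qed
    show "?f ` {w \<in> totatives P. [w = r] (mod m)} \<subseteq> {w \<in> totatives P. [w = r'] (mod m)}"
    proof safe
      fix w assume w: "w \<in> totatives P" "[w = r] (mod m)"
      have co: "coprime (?f w) P" using w w0(2) P by (simp add: in_totatives_iff)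
      then have "?f w > 0" using P by (cases "?f w = 0") auto
      with co P show "?f w \<in> totatives P" by (simp add: in_totatives_iff less_imp_le)
      have "[?f w = w * w0] (mod m)" using assms(1) by (simp add: cong_def mod_mod_cancel)
      also have "[w * w0 = r * w0] (mod m)" using w(2) by (rule cong_scalar_right)
      also note rw0
      finally show "[?f w = r'] (mod m)" .
    qed
  qed simp
qed

text \<open>The totatives of \<open>P\<close> split into the reduced classes modulo m, all of the
  same size.\<close>

lemma card_totatives_cong:
  fixes P m r :: nat
  assumes "m dvd P" "P > 0" "coprime r m"
  shows "card {w \<in> totatives P. [w = r] (mod m)} * totient m = totient P"
proof -
  have m: "m > 0" using assms by (auto intro: Nat.gr0I)
  let ?F = "\<lambda>r. {w \<in> totatives P. [w = r] (mod m)}"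
  have "totatives P = (\<Union>r\<in>totatives m. ?F r)"
  proof (intro equalityI subsetI)
    fix w assume w: "w \<in> totatives P"
    have com: "coprime w m" using w assms(1) by (meson coprime_divisors dvd_refl in_totatives_iff)
    show "w \<in> (\<Union>r\<in>totatives m. ?F r)"
    proof (cases "m = 1")
      case False
      with m have "m > 1" by simp
      moreover from this com have "w mod m > 0" by (cases "w mod m = 0") auto
      ultimately have "w mod m \<in> totatives m"
        using com m by (simp add: in_totatives_iff less_imp_le)
      moreover have "[w = w mod m] (mod m)" by (simp add: cong_def)
      ultimately show ?thesis using w by blast
    qed (use w in auto)
  qed auto
  moreover have "?F r1 \<inter> ?F r2 = {}" if "r1 \<in> totatives m" "r2 \<in> totatives m" "r1 \<noteq> r2" for r1 r2
  proof (cases "m = 1")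
    case True then show ?thesis using that by simp
  next
    case False
    with m have "m > 1" by simp
    then have "r1 < m" "r2 < m" using that totatives_less by auto
    then show ?thesis using that(3) by (auto simp: cong_def)
  qed
  ultimately have "card (totatives P) = (\<Sum>r'\<in>totatives m. card (?F r'))"
    using card_UN_disjoint[of "totatives m" ?F] by auto
  also have "\<dots> = (\<Sum>r'\<in>totatives m. card (?F r))"
    using assms card_totatives_cong_mono[OF assms(1,2)]
    by (intro sum.cong) (auto simp: in_totatives_iff intro!: antisym)
  finally show ?thesis by (simp add: totient_def)
qed

text \<open>A class that contains a totative is reduced, and any other class counts zero.\<close>

lemma card_totatives_cong_le:
  fixes P m r :: nat
  assumes "m dvd P" "P > 0"
  shows "card {w \<in> totatives P. [w = r] (mod m)} * totient m \<le> totient P"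
proof (cases "{w \<in> totatives P. [w = r] (mod m)} = {}")
  case False
  then obtain w where w: "w \<in> totatives P" "[w = r] (mod m)" by blast
  then have "coprime w m" using assms(1) by (meson coprime_divisors dvd_refl in_totatives_iff)
  with w(2) have "coprime r m" by (rule cong_imp_coprime)
  with assms show ?thesis by (simp add: card_totatives_cong)
next
  case True
  then show ?thesis by (metis (lifting) card.empty mult_zero_left zero_le)
qed

section \<open>Counting in residue classes, gcd arithmetic and tails of sums\<close>

lemma card_cong_subset_le:
  fixes X :: "nat set"
  assumes "m > 0" "X \<subseteq> {..<J}" "\<And>i j. i \<in> X \<Longrightarrow> j \<in> X \<Longrightarrow> [i = j] (mod m)"
  shows "card X \<le> (J - 1) div m + 1"
proof -
  have "inj_on (\<lambda>j. j div m) X"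
    using assms(3) by (intro inj_onI) (metis cong_def div_mult_mod_eq)
  moreover have "(\<lambda>j. j div m) ` X \<subseteq> {..(J - 1) div m}"
    using assms(2) by (auto intro!: div_le_mono)
  ultimately have "card X \<le> card {..(J - 1) div m}" by (intro card_inj_on_le) auto
  then show ?thesis by simp
qed

text \<open>The class of 1 modulo a contains \<phi>(ab)/\<phi>(a) totatives of ab, and it has at
  most b elements. Totatives start at 1, whence the quotient of w - 1.\<close>

lemma totient_mult_le:
  fixes a b :: nat
  assumes "a > 0" "b > 0"
  shows "totient (a * b) \<le> b * totient a"
proof -
  let ?X = "{w \<in> totatives (a * b). [w = 1] (mod a)}"
  have "inj_on (\<lambda>w. (w - 1) div a) ?X"
  proof (rule inj_onI)
    fix x y assume *: "x \<in> ?X" "y \<in> ?X" "(x - 1) div a = (y - 1) div a"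
    then have "x > 0" "y > 0" by (auto simp: in_totatives_iff)
    with * have "a dvd x - 1" "a dvd y - 1" by (auto simp: cong_altdef_nat)
    with * have "x - 1 = y - 1" using dvd_div_eq_iff by blast
    with \<open>x > 0\<close> \<open>y > 0\<close> show "x = y" by linarith
  qed
  moreover have "(\<lambda>w. (w - 1) div a) ` ?X \<subseteq> {..<b}"
  proof safe
    fix w assume "w \<in> totatives (a * b)"
    then have "w - 1 < b * a" by (auto simp: in_totatives_iff mult.commute)
    then show "(w - 1) div a < b" by (rule less_mult_imp_div_less)
  qed
  ultimately have "card ?X \<le> card {..<b}" by (intro card_inj_on_le) auto
  moreover have "card ?X * totient a = totient (a * b)"
    using assms by (intro card_totatives_cong) auto
  ultimately show ?thesis by (metis card_lessThan mult_le_mono1)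
qed

text \<open>The gcd with a fixed number distributes over lcm. This serves to gather finitely many
  bad divisors into one number.\<close>

lemma gcd_Lcm_image_dvd:
  fixes s :: "'b \<Rightarrow> nat"
  assumes "finite A" "\<And>a. a \<in> A \<Longrightarrow> gcd (s a) P dvd c"
  shows "gcd (Lcm (s ` A)) P dvd c"
  using assms
proof (induction A rule: finite_induct)
  case (insert x F)
  have "gcd (Lcm (s ` insert x F)) P = lcm (gcd (s x) P) (gcd (Lcm (s ` F)) P)"
    by (simp add: gcd_lcm_distrib gcd.commute)
  with insert show ?case by simp
qed simp

text \<open>F is chosen with its sum within \<epsilon> of the supremum of all finite sums, so no
  disjoint finite set can add \<epsilon>.\<close>

lemma finite_sums_tail:
  fixes f :: "'a \<Rightarrow> real"
  assumes "\<And>x. x \<in> A \<Longrightarrow> f x \<ge> 0" "\<And>F. finite F \<Longrightarrow> F \<subseteq> A \<Longrightarrow> sum f F \<le> C" "\<epsilon> > 0"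
  obtains F where "finite F" "F \<subseteq> A" "\<And>D. finite D \<Longrightarrow> D \<subseteq> A - F \<Longrightarrow> sum f D < \<epsilon>"
proof -
  define X where "X = {sum f F |F. finite F \<and> F \<subseteq> A}"
  have ne: "X \<noteq> {}" and bdd: "bdd_above X" using assms(2) unfolding X_def by (auto simp: bdd_above_def)
  have "Sup X - \<epsilon> < Sup X" using assms(3) by simp
  then obtain y where y: "y \<in> X" "Sup X - \<epsilon> < y" using less_cSupD[OF ne] by blast
  from y(1) obtain F where F: "finite F" "F \<subseteq> A" "y = sum f F" unfolding X_def by blast
  have "sum f D < \<epsilon>" if D: "finite D" "D \<subseteq> A - F" for D
  proof -
    have "sum f (F \<union> D) \<in> X" using F D unfolding X_def by blast
    then have "sum f (F \<union> D) \<le> Sup X" using bdd by (simp add: cSup_upper)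
    moreover have "sum f (F \<union> D) = sum f F + sum f D"
      using F D by (intro sum.union_disjoint) auto
    ultimately show ?thesis using F(3) y(2) by linarith
  qed
  with F that show ?thesis by blast
qed

text \<open>Cancelling k leaves a congruence modulo b/gcd(b, k), and b/gcd(b, d) divides this
  modulus. The result refers to d instead of the multiplier k, which is what the counting arguments
  need.\<close>

lemma cong_mult_cancel_div_gcd:
  fixes k i j b d :: nat
  assumes "[k * i = k * j] (mod b)" "gcd b k dvd d" "b > 0"
  shows "[i = j] (mod b div gcd b d)"
proof -
  define g where "g = gcd b k"
  have g: "g > 0" using assms(3) by (simp add: g_def)
  obtain b' k' where b': "b = g * b'" and k': "k = g * k'"
    unfolding g_def by (meson dvdE gcd_dvd1 gcd_dvd2)
  have "coprime b' k'"
    proof -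
    have "g * gcd b' k' = g * 1" using g_def unfolding gcd_mult_distrib_nat b'[symmetric] k'[symmetric] by simp
    then show ?thesis using g by (simp add: coprime_iff_gcd_eq_1)
  qed
  have "g dvd gcd b d" using assms(2) by (simp add: g_def)
  then obtain z where z: "gcd b d = g * z" by (rule dvdE)
  obtain y where y: "b = gcd b d * y" by (meson dvdE gcd_dvd1)
  have "g * b' = g * (z * y)" using y unfolding z b'[symmetric] by (simp only: mult.assoc)
  then have "b' = z * y" using g by simp
  moreover have "b div gcd b d = y"
  proof -
    have "gcd b d > 0" using assms(3) by simp
    then show ?thesis using nonzero_mult_div_cancel_left[of "gcd b d" y] y[symmetric] by simp
  qed
  ultimately have dv: "b div gcd b d dvd b'" by simp
  have "[int (k * i) = int (k * j)] (mod int b)" using assms(1) by (simp only: cong_int_iff)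
  then have "int b dvd int k * int i - int k * int j" by (simp only: cong_iff_dvd_diff of_nat_mult)
  moreover have "int k * int i - int k * int j = int g * (int k' * (int i - int j))"
    unfolding k' by (simp add: algebra_simps)
  ultimately have "int g * int b' dvd int g * (int k' * (int i - int j))"
    using b' by (metis of_nat_mult)
  then have "int b' dvd int k' * (int i - int j)" using g by simp
  moreover have "coprime (int b') (int k')" using \<open>coprime b' k'\<close> by simp
  ultimately have "int b' dvd int i - int j" by (simp add: coprime_dvd_mult_right_iff)
  then have "[i = j] (mod b')" by (simp add: cong_int_iff[symmetric] cong_iff_dvd_diff)
  with dv show ?thesis by (rule cong_dvd_modulus_nat[rotated])
qed

section \<open>Periodic sets covered by multiples\<close>

text \<open>The summand of the limit hypothesis, with the distinguished generator as first argument
  so that \<open>weight a\<close> is the function to be summed.\<close>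

definition weight :: "nat \<Rightarrow> nat \<Rightarrow> real" where
  "weight a b = 1 / real (totient (b div gcd b a))"

lemma mem_multiples: "x \<in> multiples A \<longleftrightarrow> (\<exists>a\<in>A. int a dvd x)"
  by (auto simp: multiples_def dvd_def)

text \<open>One level in isolation: \<open>E\<close> stands for the essential holes at level n and
  \<open>P\<close> for p_n.\<close>

locale hole_cover =
  fixes E :: "int set" and A :: "nat set" and S :: "nat \<Rightarrow> nat set" and P :: nat
  assumes P_pos: "P > 0"
    and periodic: "\<And>x y. x \<in> E \<Longrightarrow> [x = y] (mod int P) \<Longrightarrow> y \<in> E"
    and A_pos: "\<And>a. a \<in> A \<Longrightarrow> a > 0"
    and E_eq: "E = (\<Union>a\<in>A. multiples {a} - multiples (S a))"
    and nonempty: "\<And>a. a \<in> A \<Longrightarrow> multiples {a} - multiples (S a) \<noteq> {}"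
begin

lemma mem_E_iff: "x \<in> E \<longleftrightarrow> (\<exists>a\<in>A. int a dvd x \<and> (\<forall>s\<in>S a. \<not> int s dvd x))"
  unfolding E_eq by (simp add: mem_multiples)

text \<open>Some multiple of a escapes all divisors in \<open>S a\<close>, and what divides a would
  divide that multiple too.\<close>

lemma generator_mem:
  assumes "a \<in> A"
  shows "int a \<in> E"
proof -
  obtain x where "x \<in> multiples {a}" "x \<notin> multiples (S a)" using nonempty[OF assms] by blast
  then have x: "int a dvd x" "\<And>s. s \<in> S a \<Longrightarrow> \<not> int s dvd x"
    by (auto simp: mem_multiples)
  then have "\<not> int s dvd int a" if "s \<in> S a" for s
    using that dvd_trans by blast
  with assms show ?thesis unfolding mem_E_iff by (intro bexI[of _ a] conjI ballI) auto
qed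

text \<open>Otherwise the elements of the class of $a$ modulo $P$ that are multiples of $a$ have density
  at most $1/2$ in that class, and the other generators are too sparse to cover the rest.\<close>

lemma generator_dvd_period:
  assumes a: "a \<in> A" and le: "\<And>F. finite F \<Longrightarrow> F \<subseteq> A - {a} \<Longrightarrow> sum (weight a) F \<le> 1/4"
  shows "a dvd P"
proof (rule ccontr)
  assume nd: "\<not> a dvd P"
  define m where "m b = b div gcd b a" for b
  have m_pos: "m b > 0" if "b \<in> A" for b
  proof -
    have "gcd b a * m b = b" by (simp add: m_def)
    then show ?thesis using A_pos[OF that] by (metis mult_0_right neq0_conv)
  qed
  have inv_le: "1 / real (m b) \<le> weight a b" if "b \<in> A" for b
    using m_pos[OF that] totient_le[of "m b"] unfolding weight_def m_def[symmetric]
    by (intro divide_left_mono) auto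
  have w_nonneg: "weight a b \<ge> 0" for b by (simp add: weight_def)
  \<comment> \<open>The tail bound contains 1/P because \<open>C_tail\<close> below loses a factor
    \<open>P\<close>; the tail then contributes J/8 plus a constant.\<close>
  obtain F where F: "finite F" "F \<subseteq> A - {a}"
    and tail: "\<And>D. finite D \<Longrightarrow> D \<subseteq> A - {a} - F \<Longrightarrow> sum (weight a) D < 1 / (8 * real P)"
    using finite_sums_tail[of "A - {a}" "weight a" "1/4" "1 / (8 * real P)"] w_nonneg le P_pos by auto
  define C where "C b J = {j \<in> {..<J}. b dvd a + P * j}" for b J
  have finC: "finite (C b J)" for b J by (simp add: C_def)
  \<comment> \<open>The counted j are congruent modulo \<open>m b\<close>, since gcd(b, P) must
    divide a. The additive error 1 is affordable only for the finitely many b in F.\<close>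
  have C_bound: "real (card (C b J)) \<le> real J * weight a b + 1" if b: "b \<in> A" for b J
  proof -
    have "[i = j] (mod m b)" if "i \<in> C b J" "j \<in> C b J" for i j
    proof -
      have d: "b dvd a + P * i" "b dvd a + P * j" using that by (auto simp: C_def)
      have "gcd b P dvd a + P * i" using d(1) by (rule dvd_trans[OF gcd_dvd1])
      moreover have "gcd b P dvd P * i" by simp
      ultimately have "gcd b P dvd a" by (simp add: dvd_add_left_iff)
      moreover have "[a + P * i = a + P * j] (mod b)" using d by (simp only: cong_def mod_eq_0_iff_dvd[symmetric])
      then have "[P * i = P * j] (mod b)" by (simp add: cong_add_lcancel_nat)
      ultimately show ?thesis
        unfolding m_def using A_pos[OF b] by (intro cong_mult_cancel_div_gcd) auto
    qed
    then have "card (C b J) \<le> (J - 1) div m b + 1"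
      using m_pos[OF b] by (intro card_cong_subset_le) (auto simp: C_def)
    also have "\<dots> \<le> J div m b + 1" by (simp add: div_le_mono)
    finally have "real (card (C b J)) \<le> real (J div m b) + 1" by linarith
    also have "\<dots> \<le> real J / real (m b) + 1" using of_nat_div_le_of_nat by simp
    also have "real J / real (m b) \<le> real J * weight a b"
      using mult_left_mono[OF inv_le[OF b], of "real J"] by simp
    finally show ?thesis by simp
  qed
  \<comment> \<open>Counting all positive multiples of b up to a + P J avoids the error 1, at the
    price of a factor \<open>P\<close>.\<close>
  have C_tail: "real (card (C b J)) \<le> (real a + real P * real J) * weight a b" if b: "b \<in> A" for b J
  proof -
    have "inj_on (\<lambda>j. (a + P * j) div b) (C b J)"
    proof (rule inj_onI)
      fix x y assume "x \<in> C b J" "y \<in> C b J" "(a + P * x) div b = (a + P * y) div b"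
      then have "a + P * x = a + P * y" unfolding C_def using dvd_div_eq_iff by blast
      then show "x = y" using P_pos by simp
    qed
    moreover have "(\<lambda>j. (a + P * j) div b) ` C b J \<subseteq> {1..(a + P * J) div b}"
      using A_pos[OF a] A_pos[OF b]
      by (auto simp: C_def div_le_mono Suc_le_eq div_greater_zero_iff intro!: dvd_imp_le)
    ultimately have "card (C b J) \<le> card {1..(a + P * J) div b}" by (intro card_inj_on_le) auto
    then have "real (card (C b J)) \<le> real ((a + P * J) div b)" by simp
    also have "\<dots> \<le> real (a + P * J) / real b" by (rule of_nat_div_le_of_nat)
    also have "\<dots> \<le> real (a + P * J) / real (m b)"
      using m_pos[OF b] A_pos[OF b] by (intro divide_left_mono) (auto simp: m_def)
    also have "\<dots> \<le> real (a + P * J) * weight a b"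
      using mult_left_mono[OF inv_le[OF b], of "real (a + P * J)"] by simp
    finally show ?thesis by simp
  qed
  \<comment> \<open>As a does not divide \<open>P\<close>, the spacing a/gcd(a, P) of these j is at
    least 2.\<close>
  have C_self: "real (card (C a J)) \<le> real J / 2 + 1" for J
  proof -
    have k: "a div gcd a P \<ge> 2"
    proof -
      have e: "gcd a P * (a div gcd a P) = a" by simp
      have "a div gcd a P \<noteq> 0" using e A_pos[OF a] by (metis mult_0_right less_irrefl)
      moreover have "a div gcd a P \<noteq> 1"
      proof
        assume "a div gcd a P = 1"
        with e have "gcd a P = a" by simp
        with nd show False by (metis gcd_dvd2)
      qed
      ultimately show ?thesis by linarith
    qed
    have "[i = j] (mod (a div gcd a P))" if "i \<in> C a J" "j \<in> C a J" for i j
    proof -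
      have d: "a dvd a + P * i" "a dvd a + P * j" using that by (auto simp: C_def)
      then have "[a + P * i = a + P * j] (mod a)" by (simp only: cong_def mod_eq_0_iff_dvd[symmetric])
      then have "[P * i = P * j] (mod a)" by (simp add: cong_add_lcancel_nat)
      then show ?thesis using A_pos[OF a] by (intro cong_mult_cancel_div_gcd) auto
    qed
    then have "card (C a J) \<le> (J - 1) div (a div gcd a P) + 1"
      using k by (intro card_cong_subset_le) (auto simp: C_def)
    also have "(J - 1) div (a div gcd a P) \<le> J div (a div gcd a P)" by (simp add: div_le_mono)
    also have "\<dots> \<le> J div 2" using k by (intro div_le_mono2) auto
    finally show ?thesis by linarith
  qed
  \<comment> \<open>The shares of J are 1/4 from F, 1/8 from the other generators and 1/2 from a
    itself, in total 7/8; the remaining terms do not grow with J.\<close>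
  have main: "real J \<le> real J / 4 + real (card F) + (real a + real P * real J) / (8 * real P) + (real J / 2 + 1)" for J
  proof -
    define D where "D = {b \<in> A - {a} - F. b \<le> a + P * J}"
    have finD: "finite D" unfolding D_def by (rule finite_subset[of _ "{..a + P * J}"]) auto
    have "{..<J} \<subseteq> (\<Union>b\<in>F. C b J) \<union> (\<Union>b\<in>D. C b J) \<union> C a J"
    proof
      fix j assume j: "j \<in> {..<J}"
      have "int (a + P * j) \<in> E"
        using periodic[OF generator_mem[OF a], of "int (a + P * j)"] by (simp add: cong_def)
      then obtain b where b: "b \<in> A" "int b dvd int (a + P * j)"
        unfolding mem_E_iff by blast
      then have bj: "j \<in> C b J" using j by (simp add: C_def del: of_nat_add of_nat_mult)
      have "b \<le> a + P * j" using b(2) A_pos[OF a] by (intro dvd_imp_le) (auto simp del: of_nat_add of_nat_mult)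
      then have "b \<le> a + P * J" using j by (metis add_left_mono le_trans lessThan_iff less_imp_le mult_le_mono2)
      with b(1) bj show "j \<in> (\<Union>b\<in>F. C b J) \<union> (\<Union>b\<in>D. C b J) \<union> C a J"
        unfolding D_def by blast
    qed
    then have "card {..<J} \<le> card ((\<Union>b\<in>F. C b J) \<union> (\<Union>b\<in>D. C b J) \<union> C a J)"
      using F finD finC by (intro card_mono) auto
    also have "\<dots> \<le> (\<Sum>b\<in>F. card (C b J)) + (\<Sum>b\<in>D. card (C b J)) + card (C a J)"
      using card_Un_le[of "(\<Union>b\<in>F. C b J) \<union> (\<Union>b\<in>D. C b J)" "C a J"]
        card_Un_le[of "\<Union>b\<in>F. C b J" "\<Union>b\<in>D. C b J"]
        card_UN_le[OF F(1), of "\<lambda>b. C b J"] card_UN_le[OF finD, of "\<lambda>b. C b J"] by linarith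
    finally have "real J \<le> (\<Sum>b\<in>F. real (card (C b J))) + (\<Sum>b\<in>D. real (card (C b J))) + real (card (C a J))"
      by (simp flip: of_nat_sum of_nat_add)
    moreover have "(\<Sum>b\<in>F. real (card (C b J))) \<le> (\<Sum>b\<in>F. real J * weight a b + 1)"
      using F(2) by (intro sum_mono C_bound) auto
    moreover have "(\<Sum>b\<in>F. real J * weight a b + 1) = real J * sum (weight a) F + real (card F)"
      by (simp add: sum.distrib sum_distrib_left)
    moreover have "real J * sum (weight a) F \<le> real J * (1/4)"
      using le[OF F] by (intro mult_left_mono) auto
    moreover have "(\<Sum>b\<in>D. real (card (C b J))) \<le> (\<Sum>b\<in>D. (real a + real P * real J) * weight a b)"
      by (intro sum_mono C_tail) (auto simp: D_def)
    moreover have "(\<Sum>b\<in>D. (real a + real P * real J) * weight a b) = (real a + real P * real J) * sum (weight a) D"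
      by (simp add: sum_distrib_left)
    moreover have "(real a + real P * real J) * sum (weight a) D \<le> (real a + real P * real J) * (1 / (8 * real P))"
    proof (rule mult_left_mono)
      have "D \<subseteq> A - {a} - F" by (auto simp: D_def)
      then show "sum (weight a) D \<le> 1 / (8 * real P)" using tail[OF finD] by (simp add: less_imp_le)
    qed simp
    moreover have "(real a + real P * real J) * (1 / (8 * real P)) = (real a + real P * real J) / (8 * real P)"
      by simp
    ultimately show ?thesis using C_self[of J] by linarith
  qed
  obtain J :: nat where J: "real J > 8 * (real (card F) + real a + 1)"
    using reals_Archimedean2 by blast
  have "(real a + real P * real J) / (8 * real P) \<le> real a + real J / 8"
  proof -
    have "real a / (8 * real P) \<le> real a / 1" using P_pos by (intro divide_left_mono) auto
    then show ?thesis using P_pos by (simp add: field_simps)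
  qed
  with main[of J] J show False by (simp add: field_simps)
qed

text \<open>The sets $S(a)$ may be infinite, but by periodicity each $s$ can be replaced by $\gcd(s, P)$
  in the condition on $c$: if this failed for every $a \mid c$, a single element of the class of $c$
  would be divisible by one bad $s$ for each such $a$.\<close>

lemma exists_reduced_generator:
  assumes dv: "\<And>a. a \<in> A \<Longrightarrow> a dvd P" and c: "int c \<in> E"
  obtains a where "a \<in> A" "a dvd c" "\<And>s. s \<in> S a \<Longrightarrow> \<not> gcd s P dvd c"
proof (rule ccontr)
  assume "\<not> thesis"
  then have "\<forall>a\<in>{a \<in> A. a dvd c}. \<exists>s\<in>S a. gcd s P dvd c" using that by blast
  then obtain s where s: "\<And>a. a \<in> A \<Longrightarrow> a dvd c \<Longrightarrow> s a \<in> S a \<and> gcd (s a) P dvd c"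
    using bchoice[of "{a \<in> A. a dvd c}" "\<lambda>a s. s \<in> S a \<and> gcd s P dvd c"] by auto
  define L where "L = Lcm (s ` {a \<in> A. a dvd c})"
  have "finite A" using dv P_pos by (intro finite_subset[of A "{d. d dvd P}"]) auto
  then have "gcd L P dvd c" unfolding L_def using s by (intro gcd_Lcm_image_dvd) auto
  then have "gcd (int L) (int P) dvd int c" by simp
  then obtain z where z: "int c = gcd (int L) (int P) * z" by (rule dvdE)
  \<comment> \<open>Bezout makes \<open>u * z * int L\<close> a multiple of L in the class of c
    modulo \<open>P\<close>, so it lies in \<open>E\<close>. The generator that puts it there
    divides \<open>P\<close>, hence also c.\<close>
  obtain u v where uv: "u * int L + v * int P = gcd (int L) (int P)" using bezout_int by blast
  have e: "int c = u * z * int L + v * z * int P" unfolding z uv[symmetric] by (simp add: algebra_simps)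
  have "[int c = u * z * int L] (mod int P)" unfolding e by (simp add: cong_def)
  then have "u * z * int L \<in> E" using periodic[OF c] by blast
  then obtain a where a: "a \<in> A" "int a dvd u * z * int L" "\<And>s. s \<in> S a \<Longrightarrow> \<not> int s dvd u * z * int L"
    unfolding mem_E_iff by blast
  have "int a dvd int P" using dv[OF a(1)] by simp
  with a(2) have "int a dvd int c" unfolding e by simp
  then have ac: "a dvd c" by simp
  then have "s a dvd L" using a(1) unfolding L_def by (intro dvd_Lcm) auto
  then have "int (s a) dvd u * z * int L" by simp
  with a(1,3) s ac show False by blast
qed

text \<open>Replacing $h$ by $c = \gcd(h, a Q) w$ with $w$ prime to $P$ keeps its class modulo $Q$ and makes
  $c/a$ prime to $P$ up to a divisor of $Q$. The elements $c w'$, where $w' \equiv 1$ modulo $Q$ is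
  prime to $P$, all lie in $E$, and few of their translates are divisible by a generator other
  than $a$.\<close>

lemma common_generator_dvd:
  fixes Q h :: nat and b1 b2 :: int
  assumes Q: "Q dvd P" and h: "int h \<in> E"
    and small: "\<And>a F. a \<in> A \<Longrightarrow> finite F \<Longrightarrow> F \<subseteq> A - {a} \<Longrightarrow> sum (weight a) F \<le> 1 / (4 * real Q ^ 2)"
    and trans: "\<And>x. x \<in> E \<Longrightarrow> [x = int h] (mod int Q) \<Longrightarrow> x + b1 \<in> E \<and> x + b2 \<in> E"
  obtains a where "a \<in> A" "int a dvd b1" "int a dvd b2"
proof -
  have Q_pos: "Q > 0" using Q P_pos by (auto intro: Nat.gr0I)
  have "1 / (4 * real Q ^ 2) \<le> 1 / 4" using Q_pos by (simp add: field_simps)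
  then have dv: "a dvd P" if "a \<in> A" for a
    using generator_dvd_period[OF that order_trans[OF small[OF that]]] by blast
  have finA: "finite A" using dv P_pos by (intro finite_subset[of A "{d. d dvd P}"]) auto
  obtain a where a: "a \<in> A" "a dvd h" "\<And>s. s \<in> S a \<Longrightarrow> \<not> gcd s P dvd h"
    using exists_reduced_generator[OF dv h] by blast
  \<comment> \<open>The gcd with a Q, not with Q alone, keeps the factor a of h in c; the cofactors
    u and v are coprime, so the class of u modulo v contains a number prime to
    \<open>P\<close>.\<close>
  define g where "g = gcd h (a * Q)"
  have "a * Q > 0" using A_pos[OF a(1)] Q_pos by simp
  then have g_pos: "g > 0" by (simp add: g_def)
  obtain u v where u: "h = g * u" and v: "a * Q = g * v"
    unfolding g_def by (meson dvdE gcd_dvd1 gcd_dvd2)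
  have "coprime u v"
  proof -
    have "g * gcd u v = g * 1" using g_def unfolding gcd_mult_distrib_nat u[symmetric] v[symmetric] by simp
    then show ?thesis using g_pos by (simp add: coprime_iff_gcd_eq_1)
  qed
  then obtain w1 where w1: "[w1 = u] (mod v)" "coprime w1 P"
    using exists_coprime_in_class P_pos by metis
  define c where "c = g * w1"
  have "[c = h] (mod a * Q)"
    unfolding c_def u v using w1(1) by (metis cong_cmult_leftI)
  then have c_h: "[c = h] (mod Q)" by (rule cong_dvd_modulus_nat) simp
  have a_g: "a dvd g" using a(2) by (simp add: g_def)
  \<comment> \<open>Since \<open>w1\<close> and w are prime to \<open>P\<close>, a divisor gcd(s, P)
    of c w divides g and then h, against the choice of a.\<close>
  have mem: "int (c * w) \<in> E" if w: "coprime w P" for w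
  proof -
    have "\<not> s dvd c * w" if s: "s \<in> S a" for s
    proof
      assume "s dvd c * w"
      then have "gcd s P dvd g * (w1 * w)" unfolding c_def by (metis dvd_trans gcd_dvd1 mult.assoc)
      moreover have "coprime (gcd s P) (w1 * w)"
        using w w1(2) by (meson coprime_commute coprime_divisors coprime_mult_left_iff dvd_refl gcd_dvd2)
      ultimately have "gcd s P dvd g" by (simp add: coprime_dvd_mult_left_iff)
      then have "gcd s P dvd h" unfolding g_def by (rule dvd_trans) simp
      with a(3)[OF s] show False by blast
    qed
    moreover have "a dvd c * w" using a_g by (simp add: c_def)
    ultimately show ?thesis unfolding mem_E_iff using a(1) by (auto simp del: of_nat_mult)
  qed
  define T where "T = {w \<in> totatives P. [w = 1] (mod Q)}"
  define Bad where "Bad b a' = {w \<in> totatives P. int a' dvd int (c * w) + b}" for a' and b :: int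
  have finT: "finite T" and finBad: "finite (Bad b a')" for a' b by (simp_all add: T_def Bad_def)
  \<comment> \<open>The bad w lie in one class modulo n = a'/gcd(a', c). The quotient e of gcd(a',
    c) by gcd(a', a) divides Q, so replacing \<phi>(n) by the totient in the weight costs at most a
    factor Q.\<close>
  have Bad_le: "real (card (Bad b a')) \<le> real Q * real (totient P) * weight a a'"
    if a': "a' \<in> A" for a' b
  proof (cases "Bad b a' = {}")
    case True then show ?thesis by (simp add: weight_def)
  next
    case False
    then obtain w0 where w0: "w0 \<in> Bad b a'" by blast
    define n where "n = a' div gcd a' c"
    have n: "a' = gcd a' c * n" by (simp add: n_def)
    have "a' > 0" using A_pos[OF a'] .
    then have n_pos: "n > 0" using n by (metis mult_0_right neq0_conv)
    have "Bad b a' \<subseteq> {w \<in> totatives P. [w = w0] (mod n)}"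
    proof
      fix w assume w: "w \<in> Bad b a'"
      have "int a' dvd (int (c * w) + b) - (int (c * w0) + b)"
        using w w0 unfolding Bad_def by (intro dvd_diff) auto
      then have "[int (c * w) = int (c * w0)] (mod int a')" by (simp add: cong_iff_dvd_diff)
      then have "[c * w = c * w0] (mod a')" by (simp only: cong_int_iff)
      then have "[w = w0] (mod n)"
        unfolding n_def using \<open>a' > 0\<close> by (intro cong_mult_cancel_div_gcd) auto
      with w show "w \<in> {w \<in> totatives P. [w = w0] (mod n)}" by (simp add: Bad_def)
    qed
    then have "card (Bad b a') \<le> card {w \<in> totatives P. [w = w0] (mod n)}"
      by (intro card_mono) auto
    then have "card (Bad b a') * totient n \<le> card {w \<in> totatives P. [w = w0] (mod n)} * totient n"
      by (rule mult_le_mono1)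
    also have "\<dots> \<le> totient P"
    proof (rule card_totatives_cong_le[OF _ P_pos])
      have "n dvd a'" unfolding n_def by (metis dvd_div_mult_self dvd_triv_left gcd_dvd1)
      then show "n dvd P" using dv[OF a'] by (rule dvd_trans)
    qed
    finally have le1: "card (Bad b a') * totient n \<le> totient P" .
    define e where "e = gcd a' c div gcd a' a"
    have "a dvd c" using a_g by (simp add: c_def)
    then have "gcd a' a dvd gcd a' c" by (meson dvd_trans gcd_dvd1 gcd_dvd2 gcd_greatest)
    then have e: "gcd a' c = gcd a' a * e" by (simp add: e_def)
    have g1_pos: "gcd a' a > 0" using \<open>a' > 0\<close> by simp
    have "e dvd Q"
    proof -
      have "coprime (gcd a' c) w1"
        using w1(2) dv[OF a'] by (meson coprime_commute coprime_divisors dvd_refl dvd_trans gcd_dvd1)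
      moreover have "gcd a' c dvd g * w1" by (simp add: c_def)
      ultimately have "gcd a' c dvd g" by (simp add: coprime_dvd_mult_left_iff)
      then have "gcd a' c dvd a * Q" unfolding g_def by (rule dvd_trans) simp
      then have "gcd a' c dvd gcd (a' * Q) (a * Q)" by (simp add: dvd_mult2)
      also have "gcd (a' * Q) (a * Q) = gcd a' a * Q" by (simp add: gcd_mult_distrib_nat mult.commute)
      finally have "gcd a' a * e dvd gcd a' a * Q" unfolding e .
      then show ?thesis using g1_pos nat_mult_dvd_cancel1 by blast
    qed
    then have e_le: "e \<le> Q" "e > 0" using Q_pos by (auto intro: dvd_imp_le Nat.gr0I)
    have "a' = gcd a' a * (n * e)" using n unfolding e by (simp only: mult_ac)
    then have me: "a' div gcd a' a = n * e"
      by (metis g1_pos less_irrefl nonzero_mult_div_cancel_left)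
    have "totient (n * e) \<le> e * totient n" using n_pos e_le by (intro totient_mult_le) auto
    also have "\<dots> \<le> Q * totient n" using e_le by (intro mult_le_mono1)
    finally have "card (Bad b a') * totient (n * e) \<le> card (Bad b a') * (Q * totient n)"
      by (rule mult_le_mono2)
    also have "\<dots> = Q * (card (Bad b a') * totient n)" by (simp only: mult_ac)
    also have "\<dots> \<le> Q * totient P" using le1 by (rule mult_le_mono2)
    finally have "real (card (Bad b a') * totient (n * e)) \<le> real (Q * totient P)"
      by (simp only: of_nat_le_iff)
    moreover have "totient (n * e) > 0" using n_pos e_le by simp
    ultimately show ?thesis unfolding weight_def me by (simp add: field_simps)
  qed
  have T_ge: "real (totient P) \<le> real (card T) * real Q"
  proof -
    have "totient P = card T * totient Q"
      unfolding T_def using Q P_pos by (intro card_totatives_cong[symmetric]) auto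
    also have "\<dots> \<le> card T * Q" by (intro mult_le_mono2 totient_le)
    finally show ?thesis by (simp flip: of_nat_mult)
  qed
  \<comment> \<open>\<open>T\<close> has at least \<phi>(P)/Q elements. The two translations
    together exclude at most 2 Q \<phi>(P)/(4 Q^2) = \<phi>(P)/(2 Q) of them; this is the origin of
    the constant 4 Q^2.\<close>
  have "\<exists>w\<in>T. \<forall>a'\<in>A - {a}. w \<notin> Bad b1 a' \<and> w \<notin> Bad b2 a'"
  proof (rule ccontr)
    assume "\<not> ?thesis"
    then have "T \<subseteq> (\<Union>a'\<in>A - {a}. Bad b1 a' \<union> Bad b2 a')" by blast
    then have "card T \<le> card (\<Union>a'\<in>A - {a}. Bad b1 a' \<union> Bad b2 a')"
      using finA finBad by (intro card_mono) auto
    also have "\<dots> \<le> (\<Sum>a'\<in>A - {a}. card (Bad b1 a' \<union> Bad b2 a'))"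
      using finA by (intro card_UN_le) auto
    also have "\<dots> \<le> (\<Sum>a'\<in>A - {a}. card (Bad b1 a') + card (Bad b2 a'))"
      by (intro sum_mono card_Un_le)
    finally have "real (card T) \<le> (\<Sum>a'\<in>A - {a}. real (card (Bad b1 a')) + real (card (Bad b2 a')))"
      by (simp flip: of_nat_sum of_nat_add)
    also have "\<dots> \<le> (\<Sum>a'\<in>A - {a}. 2 * real Q * real (totient P) * weight a a')"
    proof (rule sum_mono)
      fix a' assume "a' \<in> A - {a}"
      then show "real (card (Bad b1 a')) + real (card (Bad b2 a')) \<le> 2 * real Q * real (totient P) * weight a a'"
        using Bad_le[of a' b1] Bad_le[of a' b2] by simp
    qed
    also have "\<dots> = 2 * real Q * real (totient P) * sum (weight a) (A - {a})"
      by (simp add: sum_distrib_left)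
    also have "\<dots> \<le> 2 * real Q * real (totient P) * (1 / (4 * real Q ^ 2))"
      using small[OF a(1), of "A - {a}"] finA by (intro mult_left_mono) auto
    also have "\<dots> = real (totient P) / (2 * real Q)" using Q_pos by (simp add: field_simps power2_eq_square)
    finally have "real (card T) * real Q \<le> real (totient P) / 2" using Q_pos by (simp add: field_simps)
    moreover have "real (totient P) > 0" using P_pos by simp
    ultimately show False using T_ge by linarith
  qed
  then obtain w where w: "w \<in> T" "\<And>a'. a' \<in> A - {a} \<Longrightarrow> w \<notin> Bad b1 a' \<and> w \<notin> Bad b2 a'" by blast
  have "coprime w P" using w(1) by (simp add: T_def in_totatives_iff)
  then have xE: "int (c * w) \<in> E" by (rule mem)
  have "[c * w = h * 1] (mod Q)" using w(1) c_h unfolding T_def by (intro cong_mult) auto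
  then have "[int (c * w) = int h] (mod int Q)" by (simp only: cong_int_iff mult_1_right)
  with trans[OF xE] have E12: "int (c * w) + b1 \<in> E" "int (c * w) + b2 \<in> E" by blast+
  have "int a dvd b" if b: "int (c * w) + b \<in> E" "b = b1 \<or> b = b2" for b
  proof -
    obtain a' where a': "a' \<in> A" "int a' dvd int (c * w) + b" using b(1) unfolding mem_E_iff by blast
    have "a' = a"
    proof (rule ccontr)
      assume "a' \<noteq> a"
      with a' w(2)[of a'] b(2) w(1) show False by (auto simp: Bad_def T_def)
    qed
    moreover have "int a dvd int (c * w)" using a_g by (simp add: c_def)
    ultimately show ?thesis using a'(2) by (simp add: dvd_add_right_iff)
  qed
  with E12 a(1) that show ?thesis by blast
qed

end

section \<open>The odometer as a topological group\<close>

locale odometer_group =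
  fixes p :: "nat \<Rightarrow> nat"
  assumes period: "period_structure p"
begin

abbreviation "G \<equiv> odometer p"

lemma p_pos: "p n > 0"
  using period unfolding period_structure_def by blast

lemma p_dvd: "n \<le> m \<Longrightarrow> p n dvd p m"
  using period by (rule period_dvd)

lemma mod_p: "g \<in> G \<Longrightarrow> g n mod int (p n) = g n"
  unfolding odometer_def by (simp add: mod_pos_pos_trivial)

lemma cyl_mono:
  assumes "g \<in> G" "h \<in> G" "g m = h m" "n \<le> m"
  shows "g n = h n"
  using odometer_mod[OF period _ assms(4)] assms(1-3) by metis

lemma mod_p_mem:
  assumes "\<And>n. [f (Suc n) = f n] (mod int (p n))"
  shows "(\<lambda>n. f n mod int (p n)) \<in> G"
proof -
  have "f (Suc n) mod int (p (Suc n)) mod int (p n) = f n mod int (p n)" for n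
    using assms[of n] p_dvd[of n "Suc n"] by (simp add: cong_def mod_mod_cancel)
  then show ?thesis unfolding odometer_def using p_pos by auto
qed

lemma cong_Suc: "g \<in> G \<Longrightarrow> [g (Suc n) = g n] (mod int (p n))"
  unfolding odometer_def cong_def by auto

lemma Delta_mem [simp, intro]: "Delta p k \<in> G"
  unfolding Delta_def by (rule mod_p_mem) simp

lemma od_add_mem [simp, intro]: "g \<in> G \<Longrightarrow> h \<in> G \<Longrightarrow> od_add p g h \<in> G"
  unfolding od_add_def by (intro mod_p_mem cong_add cong_Suc)

lemma od_diff_mem [simp, intro]: "g \<in> G \<Longrightarrow> h \<in> G \<Longrightarrow> od_diff p g h \<in> G"
  unfolding od_diff_def by (intro mod_p_mem cong_diff cong_Suc)

lemma od_mult_mem [simp, intro]: "g \<in> G \<Longrightarrow> od_mult p j g \<in> G"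
  unfolding od_mult_def by (intro mod_p_mem cong_mult cong_Suc cong_refl)

text \<open>Points store normalized residues. Identities in the group are thereby reduced to integer
  arithmetic modulo each p_n.\<close>

lemma od_eqI: "g \<in> G \<Longrightarrow> h \<in> G \<Longrightarrow> (\<And>n. [g n = h n] (mod int (p n))) \<Longrightarrow> g = h"
  unfolding cong_def by (rule ext) (simp add: mod_p)

lemmas od_defs = od_add_def od_diff_def od_mult_def Delta_def

section \<open>Topology of subspaces of the odometer in coordinates\<close>

text \<open>One coordinate determines all lower ones, so cylinders given by a single coordinate form
  a base.\<close>

lemma openin_odometer_iff:
  assumes "B \<subseteq> G"
  shows "openin (top_of_set B) U \<longleftrightarrow> U \<subseteq> B \<and> (\<forall>h\<in>U. \<exists>n. \<forall>g\<in>B. g n = h n \<longrightarrow> g \<in> U)"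
proof safe
  assume U: "openin (top_of_set B) U"
  then show "x \<in> B" if "x \<in> U" for x using that openin_imp_subset by auto
  fix h assume h: "h \<in> U"
  obtain O' where O': "open O'" "U = B \<inter> O'" using U by (auto simp: openin_open)
  have "openin (top_of_set G) (G \<inter> O')" using O'(1) by blast
  moreover have "h \<in> G" "h \<in> G \<inter> O'" using h O' assms by auto
  ultimately obtain n where "od_cyl p n h \<subseteq> G \<inter> O'" using od_cyl_nbhd[OF period] by blast
  then show "\<exists>n. \<forall>g\<in>B. g n = h n \<longrightarrow> g \<in> U" using assms O' by (auto simp: od_cyl_def)
next
  assume U: "U \<subseteq> B" "\<forall>h\<in>U. \<exists>n. \<forall>g\<in>B. g n = h n \<longrightarrow> g \<in> U"
  then obtain N where N: "\<And>h g. h \<in> U \<Longrightarrow> g \<in> B \<Longrightarrow> g (N h) = h (N h) \<Longrightarrow> g \<in> U" by metis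
  have "open ((\<lambda>g :: nat \<Rightarrow> int. g (N h)) -` {h (N h)})" for h
    by (intro open_vimage continuous_on_product_coordinates open_discrete)
  then have "open (\<Union>h\<in>U. (\<lambda>g :: nat \<Rightarrow> int. g (N h)) -` {h (N h)})" by blast
  moreover have "U = B \<inter> (\<Union>h\<in>U. (\<lambda>g :: nat \<Rightarrow> int. g (N h)) -` {h (N h)})"
  proof (intro equalityI subsetI)
    fix x assume "x \<in> B \<inter> (\<Union>h\<in>U. (\<lambda>g :: nat \<Rightarrow> int. g (N h)) -` {h (N h)})"
    then obtain h where "x \<in> B" "h \<in> U" "x (N h) = h (N h)" by blast
    then show "x \<in> U" using N by metis
  qed (use U(1) in blast)
  ultimately show "openin (top_of_set B) U" unfolding openin_open by (intro exI conjI)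
qed

lemma interior_of_odometer:
  assumes "B \<subseteq> G" "C \<subseteq> B"
  shows "top_of_set B interior_of C = {h \<in> B. \<exists>n. \<forall>g\<in>B. g n = h n \<longrightarrow> g \<in> C}" (is "?L = ?R")
proof
  show "?L \<subseteq> ?R"
  proof
    fix h assume h: "h \<in> ?L"
    then obtain n where n: "\<forall>g\<in>B. g n = h n \<longrightarrow> g \<in> ?L"
      using openin_interior_of[of "top_of_set B" C] unfolding openin_odometer_iff[OF assms(1)] by blast
    have "?L \<subseteq> C" by (rule interior_of_subset)
    with h n assms(2) show "h \<in> ?R" by blast
  qed
  have "\<exists>n. \<forall>g\<in>B. g n = h n \<longrightarrow> g \<in> ?R" if h: "h \<in> ?R" for h
  proof -
    obtain n where n: "\<forall>g\<in>B. g n = h n \<longrightarrow> g \<in> C" using h by blast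
    have "g \<in> ?R" if "g \<in> B" "g n = h n" for g
      using n that by (intro CollectI conjI exI[of _ n]) simp_all
    then show ?thesis by blast
  qed
  then have "openin (top_of_set B) ?R"
    unfolding openin_odometer_iff[OF assms(1)] by blast
  moreover have "?R \<subseteq> C" by auto
  ultimately show "?R \<subseteq> ?L" by (rule interior_of_maximal[rotated])
qed

lemma closure_of_odometer:
  assumes "B \<subseteq> G" "C \<subseteq> B"
  shows "top_of_set B closure_of C = {h \<in> B. \<forall>n. \<exists>g\<in>C. g n = h n}" (is "?L = ?R")
proof -
  have "top_of_set B closure_of C = B - top_of_set B interior_of (B - C)"
    by (simp add: closure_of_interior_of)
  also have "\<dots> = ?R"
    using assms(2) by (subst interior_of_odometer[OF assms(1)]) auto
  finally show ?thesis .
qed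

lemma closedin_odometer_iff:
  assumes "B \<subseteq> G" "C \<subseteq> B"
  shows "closedin (top_of_set B) C \<longleftrightarrow> (\<forall>h\<in>B. (\<forall>n. \<exists>g\<in>C. g n = h n) \<longrightarrow> h \<in> C)"
proof -
  have "closedin (top_of_set B) C \<longleftrightarrow> top_of_set B closure_of C = C"
    by (rule closure_of_eq[symmetric])
  also have "\<dots> \<longleftrightarrow> {h \<in> B. \<forall>n. \<exists>g\<in>C. g n = h n} = C"
    by (simp only: closure_of_odometer[OF assms])
  also have "\<dots> \<longleftrightarrow> (\<forall>h\<in>B. (\<forall>n. \<exists>g\<in>C. g n = h n) \<longrightarrow> h \<in> C)"
    using assms(2) by blast
  finally show ?thesis .
qed

text \<open>A finite Baire argument: a point outside the closed set \<open>C l\<close> has a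
  cylinder that misses it; there the remaining sets still cover, and induction on L applies.\<close>

lemma finite_closed_cover_cyl:
  assumes "finite L" "B \<subseteq> G" "h0 \<in> B"
    and cover: "\<And>g. g \<in> B \<Longrightarrow> g n0 = h0 n0 \<Longrightarrow> \<exists>l\<in>L. g \<in> C l"
    and closed: "\<And>l h. h \<in> B \<Longrightarrow> (\<And>n. \<exists>g\<in>B \<inter> C l. g n = h n) \<Longrightarrow> h \<in> C l"
  obtains l h n where "l \<in> L" "h \<in> B" "h n0 = h0 n0" "n \<ge> n0" "\<And>g. g \<in> B \<Longrightarrow> g n = h n \<Longrightarrow> g \<in> C l"
proof -
  have "\<exists>l\<in>L. \<exists>h\<in>B. \<exists>n\<ge>n0. h n0 = h0 n0 \<and> (\<forall>g\<in>B. g n = h n \<longrightarrow> g \<in> C l)"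
    using assms(1,3) cover
  proof (induction L arbitrary: h0 n0 rule: finite_induct)
    case (insert l L)
    show ?case
    proof (cases "\<forall>g\<in>B. g n0 = h0 n0 \<longrightarrow> g \<in> C l")
      case True
      then show ?thesis using insert.prems(1) by blast
    next
      case False
      then obtain g where g: "g \<in> B" "g n0 = h0 n0" "g \<notin> C l" by blast
      have "\<not> (\<forall>n. \<exists>g'\<in>B \<inter> C l. g' n = g n)" using closed[OF g(1), of l] g(3) by blast
      then obtain n where n: "\<And>g'. g' \<in> B \<Longrightarrow> g' \<in> C l \<Longrightarrow> g' n \<noteq> g n" by blast
      define m where "m = max n n0"
      have mono: "g' n = g n" "g' n0 = h0 n0" if "g' \<in> B" "g' m = g m" for g'
        using cyl_mono[of g' g m n] cyl_mono[of g' g m n0] that g(1,2) assms(2) unfolding m_def by auto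
      have "\<exists>l\<in>L. g' \<in> C l" if g': "g' \<in> B" "g' m = g m" for g'
      proof -
        obtain k where "k \<in> insert l L" "g' \<in> C k"
          using insert.prems(2)[OF g'(1) mono(2)[OF g']] by blast
        moreover have "g' \<notin> C l" using n[OF g'(1)] mono(1)[OF g'] by blast
        ultimately show ?thesis by blast
      qed
      from insert.IH[OF g(1) this] obtain l' h k
        where *: "l' \<in> L" "h \<in> B" "k \<ge> m" "h m = g m" "\<forall>g\<in>B. g k = h k \<longrightarrow> g \<in> C l'" by blast
      have "h n0 = h0 n0" using mono(2)[OF *(2,4)] .
      moreover have "k \<ge> n0" using *(3) by (simp add: m_def)
      ultimately have "\<exists>h\<in>B. \<exists>k\<ge>n0. h n0 = h0 n0 \<and> (\<forall>g\<in>B. g k = h k \<longrightarrow> g \<in> C l')"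
        using *(2,5) by (intro bexI[of _ h] exI[of _ k] conjI)
      with *(1) show ?thesis by (intro bexI[of _ l']) simp_all
    qed
  qed auto
  with that show ?thesis by blast
qed

end

context odometer_group
begin

abbreviation plus (infixl "\<oplus>" 65) where "g \<oplus> h \<equiv> od_add p g h"

lemma plus_cong_coord: "g n = g' n \<Longrightarrow> (g \<oplus> h) n = (g' \<oplus> h) n"
  by (simp add: od_add_def)

lemma plus_assoc: "a \<in> G \<Longrightarrow> b \<in> G \<Longrightarrow> c \<in> G \<Longrightarrow> a \<oplus> b \<oplus> c = a \<oplus> (b \<oplus> c)"
  by (intro od_eqI od_add_mem) (simp_all add: od_add_def cong_def mod_simps add.assoc)

lemma plus_0: "a \<in> G \<Longrightarrow> a \<oplus> od_mult p 0 b = a"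
  by (rule ext) (simp add: od_defs mod_p)

lemma plus_Delta_0: "a \<in> G \<Longrightarrow> a \<oplus> Delta p 0 = a"
  by (rule ext) (simp add: od_defs mod_p)

end

section \<open>Closed sets with a rigidity property under translations\<close>

text \<open>\<open>rigid\<close> is the nowhere density claim tested on cylinders, the form in which
  both the density statements and the dynamical argument use it.\<close>

locale rigid_set = odometer_group p for p :: "nat \<Rightarrow> nat" +
  fixes B :: "(nat \<Rightarrow> int) set"
  assumes B_subset: "B \<subseteq> odometer p"
    and B_closed: "\<And>h. h \<in> odometer p \<Longrightarrow> (\<And>n. \<exists>g\<in>B. g n = h n) \<Longrightarrow> h \<in> B"
    and rigid: "\<And>k \<beta> h n. k \<noteq> 0 \<Longrightarrow> \<beta> \<in> odometer p \<Longrightarrow> h \<in> B \<Longrightarrow>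
      \<exists>g\<in>B. g n = h n \<and> \<not> (od_add p g \<beta> \<in> B \<and>
        od_add p (od_add p g (od_mult p 2 \<beta>)) (Delta p k) \<in> B)"
begin

lemma B_G: "g \<in> B \<Longrightarrow> g \<in> G" using B_subset by blast

text \<open>With \<open>B\<close> the boundary of $W$ and $\gamma = y_F - \Delta(k)$, these are the interior of $V_k$ and
  the set $V_k'$.\<close>

definition stable_set :: "(nat \<Rightarrow> int) \<Rightarrow> (nat \<Rightarrow> int) set" where
  "stable_set \<gamma> = {g \<in> B. \<exists>n. \<forall>g'\<in>B. g' n = g n \<longrightarrow> g' \<oplus> \<gamma> \<in> B}"

definition stable_closure :: "(nat \<Rightarrow> int) \<Rightarrow> (nat \<Rightarrow> int) set" where
  "stable_closure \<gamma> = {g \<in> G. \<forall>n. \<exists>h\<in>stable_set \<gamma>. h n = g n}"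

lemma stable_set_B: "g \<in> stable_set \<gamma> \<Longrightarrow> g \<in> B" and stable_set_plus: "g \<in> stable_set \<gamma> \<Longrightarrow> g \<oplus> \<gamma> \<in> B"
  unfolding stable_set_def by blast+

lemma stable_closure_closed:
  assumes "h \<in> G" "\<And>n. \<exists>g\<in>stable_closure \<gamma>. g n = h n"
  shows "h \<in> stable_closure \<gamma>"
proof -
  have "\<exists>x\<in>stable_set \<gamma>. x n = h n" for n
  proof -
    obtain g where g: "g \<in> stable_closure \<gamma>" "g n = h n" using assms(2) by blast
    from g(1) obtain x where "x \<in> stable_set \<gamma>" "x n = g n" unfolding stable_closure_def by blast
    with g(2) show ?thesis by auto
  qed
  with assms(1) show ?thesis unfolding stable_closure_def by blast
qed

lemma stable_set_subset_closure: "g \<in> stable_set \<gamma> \<Longrightarrow> g \<in> stable_closure \<gamma>"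
  unfolding stable_closure_def using stable_set_B B_G by blast

lemma stable_closure_B: "g \<in> stable_closure \<gamma> \<Longrightarrow> g \<in> B"
  by (rule B_closed) (auto simp: stable_closure_def stable_set_def)

text \<open>Translation is continuous, because level n of a sum depends only on level n of the
  summands.\<close>

lemma plus_closed:
  assumes "\<gamma> \<in> G" "h \<in> G" "\<And>n. \<exists>g. g n = h n \<and> g \<oplus> \<gamma> \<in> B"
  shows "h \<oplus> \<gamma> \<in> B"
proof (rule B_closed)
  show "h \<oplus> \<gamma> \<in> G" using assms by simp
  show "\<exists>g\<in>B. g n = (h \<oplus> \<gamma>) n" for n
    using assms(3)[of n] plus_cong_coord by metis
qed

lemma stable_closure_plus_B: "\<gamma> \<in> G \<Longrightarrow> g \<in> stable_closure \<gamma> \<Longrightarrow> g \<oplus> \<gamma> \<in> B"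
  by (rule plus_closed) (auto simp: stable_closure_def dest: stable_set_plus)

text \<open>This is rigidity for \<beta> = 0, written as \<Delta>(0).\<close>

lemma Delta_rigid:
  assumes "k \<noteq> 0" "h \<in> B"
  shows "\<exists>g\<in>B. g n = h n \<and> g \<oplus> Delta p k \<notin> B"
proof -
  have 2: "od_mult p 2 (Delta p 0) = Delta p 0" by (rule ext) (simp add: od_defs)
  obtain g where g: "g \<in> B" "g n = h n"
    "\<not> (g \<oplus> Delta p 0 \<in> B \<and> g \<oplus> Delta p 0 \<oplus> Delta p k \<in> B)"
    using rigid[OF assms(1) Delta_mem[of 0] assms(2), of n] unfolding 2 by blast
  then show ?thesis using plus_Delta_0[OF B_G[OF g(1)]] by (metis (lifting))
qed

context
  fixes L :: "int set" and \<delta> :: "nat \<Rightarrow> int"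
  assumes L: "finite L" and \<delta>: "\<delta> \<in> G"
    and cover: "\<And>g. g \<in> B \<Longrightarrow> \<exists>l\<in>L. g \<oplus> (\<delta> \<oplus> Delta p l) \<in> B"
begin

abbreviation "dl l \<equiv> \<delta> \<oplus> Delta p l"

lemma dl_mem: "dl l \<in> G" using \<delta> by simp

text \<open>In each cylinder around g the finite Baire argument finds a stable point for some l in
  \<open>L\<close>. By pigeonhole one l recurs at arbitrarily deep levels, and deep agreement passes
  down to every level.\<close>

lemma stable_closure_cover:
  assumes g: "g \<in> B"
  shows "\<exists>l\<in>L. g \<in> stable_closure (dl l)"
proof -
  have "\<exists>l\<in>L. \<exists>h\<in>stable_set (dl l). h n = g n" for n
  proof -
    have cl: "h \<in> {g. g \<oplus> dl l \<in> B}" if "h \<in> B" "\<And>n. \<exists>g\<in>B \<inter> {g. g \<oplus> dl l \<in> B}. g n = h n" for l h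
      using plus_closed[OF dl_mem, of h l] that B_G by blast
    obtain l h m where *: "l \<in> L" "h \<in> B" "h n = g n" "m \<ge> n"
      "\<And>g. g \<in> B \<Longrightarrow> g m = h m \<Longrightarrow> g \<in> {g. g \<oplus> dl l \<in> B}"
      by (rule finite_closed_cover_cyl[of L B g n "\<lambda>l. {g. g \<oplus> dl l \<in> B}"])
        (use L B_subset g cover cl in auto)
    then have "h \<in> stable_set (dl l)" unfolding stable_set_def by blast
    with * show ?thesis by blast
  qed
  then obtain f where f: "\<And>n. f n \<in> L" "\<And>n. \<exists>h\<in>stable_set (dl (f n)). h n = g n" by metis
  have "finite (range f)" using f(1) L by (meson finite_subset image_subsetI)
  then obtain n0 where "infinite {n \<in> UNIV. f n = f n0}"
    using pigeonhole_infinite[of "UNIV :: nat set" f] infinite_UNIV_nat by blast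
  then have unb: "\<exists>m\<ge>n. f m = f n0" for n
    unfolding infinite_nat_iff_unbounded_le by auto
  have "\<exists>h\<in>stable_set (dl (f n0)). h n = g n" for n
  proof -
    obtain m where m: "m \<ge> n" "f m = f n0" using unb by blast
    obtain h where h: "h \<in> stable_set (dl (f n0))" "h m = g m" using f(2)[of m] m(2) by metis
    then have "h n = g n" using cyl_mono[of h g m n] m(1) B_G[OF stable_set_B] B_G[OF g] by blast
    with h show ?thesis by blast
  qed
  then have "g \<in> stable_closure (dl (f n0))" unfolding stable_closure_def using B_G[OF g] by blast
  with f(1) show ?thesis by blast
qed

text \<open>Points of \<open>B\<close> near g arrive in \<open>B\<close> after one step, hence in
  the closure of some stable set; on a smaller cylinder the finite Baire argument makes one index l
  serve for all of them, and rigidity excludes l \<noteq> k.\<close>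

lemma stable_set_step:
  assumes g: "g \<in> stable_set (dl k)"
  shows "g \<oplus> dl k \<in> stable_closure (dl k)"
proof -
  obtain N where N: "\<And>g'. g' \<in> B \<Longrightarrow> g' N = g N \<Longrightarrow> g' \<oplus> dl k \<in> B" and gB: "g \<in> B"
    using g unfolding stable_set_def by blast
  have "\<exists>h\<in>stable_set (dl k). h n = (g \<oplus> dl k) n" for n
  proof -
    define n' where "n' = max n N"
    have cyl: "g' n = g n" "g' N = g N" if "g' \<in> B" "g' n' = g n'" for g'
      using cyl_mono[of g' g n' n] cyl_mono[of g' g n' N] that B_G gB unfolding n'_def by auto
    have cl: "h \<in> {g. g \<oplus> dl k \<in> stable_closure (dl l)}"
      if h: "h \<in> B" "\<And>n. \<exists>g\<in>B \<inter> {g. g \<oplus> dl k \<in> stable_closure (dl l)}. g n = h n" for l h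
    proof -
      have "\<exists>x\<in>stable_closure (dl l). x n = (h \<oplus> dl k) n" for n
        using h(2)[of n] plus_cong_coord by (metis IntE mem_Collect_eq)
      then show ?thesis using stable_closure_closed B_G[OF h(1)] dl_mem by simp
    qed
    have cov: "\<exists>l\<in>L. g' \<in> {g. g \<oplus> dl k \<in> stable_closure (dl l)}" if "g' \<in> B" "g' n' = g n'" for g'
      using stable_closure_cover[OF N[OF that(1) cyl(2)[OF that]]] by simp
    obtain l h m where *: "l \<in> L" "h \<in> B" "h n' = g n'" "m \<ge> n'"
      "\<And>g. g \<in> B \<Longrightarrow> g m = h m \<Longrightarrow> g \<in> {g. g \<oplus> dl k \<in> stable_closure (dl l)}"
      by (rule finite_closed_cover_cyl[of L B g n' "\<lambda>l. {g. g \<oplus> dl k \<in> stable_closure (dl l)}"])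
        (use L B_subset gB cov cl in auto)
    have "l = k"
    proof (rule ccontr)
      assume "l \<noteq> k"
      then obtain x where x: "x \<in> B" "x m = h m"
        "\<not> (x \<oplus> dl k \<in> B \<and> x \<oplus> od_mult p 2 (dl k) \<oplus> Delta p (l - k) \<in> B)"
        using rigid[of "l - k" "dl k" h m] *(2) dl_mem by auto
      have "x \<oplus> dl k \<in> stable_closure (dl l)" using *(5)[OF x(1,2)] by simp
      moreover from this have "x \<oplus> dl k \<oplus> dl l \<in> B" using stable_closure_plus_B dl_mem by blast
      \<comment> \<open>The two moves make up 2\<beta> + \<Delta>(l - k) with \<beta> =
        \<open>dl k\<close>, the progression in \<open>rigid\<close>.\<close>
      moreover have "x \<oplus> dl k \<oplus> dl l = x \<oplus> od_mult p 2 (dl k) \<oplus> Delta p (l - k)"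
      by (rule od_eqI, use B_G[OF x(1)] dl_mem in simp, use B_G[OF x(1)] dl_mem in simp,
          simp only: od_defs cong_def mod_simps, simp add: algebra_simps)
      ultimately show False using x(3) stable_closure_B by metis
    qed
    then have "h \<oplus> dl k \<in> stable_closure (dl k)" using *(5)[OF *(2)] by simp
    then obtain y where "y \<in> stable_set (dl k)" "y n = (h \<oplus> dl k) n" unfolding stable_closure_def by blast
    moreover have "(h \<oplus> dl k) n = (g \<oplus> dl k) n" using cyl(1)[OF *(2,3)] by (rule plus_cong_coord)
    ultimately show ?thesis by metis
  qed
  then show ?thesis unfolding stable_closure_def using B_G[OF gB] dl_mem by simp
qed

lemma stable_closure_step:
  assumes g: "g \<in> stable_closure (dl k)"
  shows "g \<oplus> dl k \<in> stable_closure (dl k)"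
proof (rule stable_closure_closed)
  show "g \<oplus> dl k \<in> G" using B_G[OF stable_closure_B[OF g]] dl_mem by simp
  show "\<exists>x\<in>stable_closure (dl k). x n = (g \<oplus> dl k) n" for n
  proof -
    obtain h where "h \<in> stable_set (dl k)" "h n = g n" using g unfolding stable_closure_def by blast
    then show ?thesis using stable_set_step plus_cong_coord by metis
  qed
qed

text \<open>A closed set invariant under a translation is invariant under its inverse, because
  multiples of $p_n$ act trivially at level $n$.\<close>

lemma stable_closure_mult:
  assumes g: "g \<in> stable_closure (dl k)"
  shows "g \<oplus> od_mult p j (dl k) \<in> stable_closure (dl k)"
proof -
  have G: "g \<in> G" using B_G[OF stable_closure_B[OF g]] .
  have nat: "g \<oplus> od_mult p (int i) (dl k) \<in> stable_closure (dl k)" for i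
  proof (induction i)
    case 0
    then show ?case using plus_0[OF G] g by simp
  next
    case (Suc i)
    have "g \<oplus> od_mult p (int (Suc i)) (dl k) = g \<oplus> od_mult p (int i) (dl k) \<oplus> dl k"
      by (rule od_eqI, use G dl_mem in simp, use G dl_mem in simp,
          simp only: od_defs cong_def mod_simps, simp add: algebra_simps)
    then show ?case using stable_closure_step[OF Suc] by simp
  qed
  show ?thesis
  proof (rule stable_closure_closed)
    show "g \<oplus> od_mult p j (dl k) \<in> G" using G dl_mem by simp
    fix n
    have "j mod int (p n) \<ge> 0" using p_pos[of n] by simp
    then have "(g \<oplus> od_mult p (int (nat (j mod int (p n)))) (dl k)) n = (g \<oplus> od_mult p j (dl k)) n"
      unfolding od_add_def od_mult_def by (simp add: mod_mult_left_eq)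
    with nat show "\<exists>x\<in>stable_closure (dl k). x n = (g \<oplus> od_mult p j (dl k)) n" by blast
  qed
qed

text \<open>Translating back by the first shift shows that otherwise a relatively open part of \<open>B\<close> would be
  translated into \<open>B\<close> by $\Delta(l - k)$.\<close>

lemma stable_set_disjoint:
  assumes "k \<noteq> l"
  shows "stable_set (dl k) \<inter> stable_set (dl l) = {}"
proof (rule ccontr)
  assume "stable_set (dl k) \<inter> stable_set (dl l) \<noteq> {}"
  then obtain g where g: "g \<in> stable_set (dl k)" "g \<in> stable_set (dl l)" by blast
  obtain N where N: "\<And>g'. g' \<in> B \<Longrightarrow> g' N = g N \<Longrightarrow> g' \<oplus> dl l \<in> B"
    using g(2) unfolding stable_set_def by blast
  \<comment> \<open>The point \<open>g \<oplus> dl k\<close> is only known to lie in the closure. A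
    nearby h in the stable set itself has a cylinder all of whose points in \<open>B\<close> are
    stable, and x is picked there.\<close>
  obtain h where h: "h \<in> stable_set (dl k)" "h N = (g \<oplus> dl k) N"
    using stable_set_step[OF g(1)] unfolding stable_closure_def by blast
  have hB: "h \<in> B" using stable_set_B[OF h(1)] .
  obtain M0 where M0: "\<And>g'. g' \<in> B \<Longrightarrow> g' M0 = h M0 \<Longrightarrow> g' \<oplus> dl k \<in> B"
    using h(1) unfolding stable_set_def by blast
  define M where "M = max M0 N"
  obtain x where x: "x \<in> B" "x M = h M" "x \<oplus> Delta p (l - k) \<notin> B"
    using Delta_rigid[of "l - k" h M] assms hB by auto
  have xc: "x M0 = h M0" "x N = h N"
    using cyl_mono[of x h M M0] cyl_mono[of x h M N] x hB B_G unfolding M_def by auto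
  then have "x \<in> stable_set (dl k)" unfolding stable_set_def using x(1) M0 by (intro CollectI conjI exI[of _ M0]) auto
  then have "x \<oplus> od_mult p (-1) (dl k) \<in> stable_closure (dl k)" using stable_closure_mult stable_set_subset_closure by blast
  then have "x \<oplus> od_mult p (-1) (dl k) \<in> B" by (rule stable_closure_B)
  moreover have "(x \<oplus> od_mult p (-1) (dl k)) N = g N"
  proof -
    have "(x \<oplus> od_mult p (-1) (dl k)) N = (g \<oplus> dl k \<oplus> od_mult p (-1) (dl k)) N"
      using xc(2) h(2) by (intro plus_cong_coord) simp
    also have "\<dots> = g N mod int (p N)" by (simp add: od_add_def od_mult_def mod_simps)
    also have "\<dots> = g N" using stable_set_B[OF g(1)] B_G mod_p by blast
    finally show ?thesis .
  qed
  ultimately have "x \<oplus> od_mult p (-1) (dl k) \<oplus> dl l \<in> B" by (rule N)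
  moreover have "x \<oplus> od_mult p (-1) (dl k) \<oplus> dl l = x \<oplus> Delta p (l - k)"
      by (rule od_eqI, use B_G[OF x(1)] dl_mem in simp, use B_G[OF x(1)] dl_mem in simp,
          simp only: od_defs cong_def mod_simps, simp add: algebra_simps)
  ultimately show False using x(3) by simp
qed

text \<open>Stable sets are relatively open, so one that meets the closure of another meets that set
  itself. The closures for l in \<open>L\<close> cover \<open>B\<close>, and disjointness then
  forces k = l.\<close>

lemma stable_set_nonempty_imp: 
  assumes "stable_set (dl k) \<noteq> {}"
  shows "k \<in> L"
proof -
  obtain g n where g: "g \<in> stable_set (dl k)" "\<And>g'. g' \<in> B \<Longrightarrow> g' n = g n \<Longrightarrow> g' \<oplus> dl k \<in> B"
    using assms unfolding stable_set_def by blast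
  obtain l where l: "l \<in> L" "g \<in> stable_closure (dl l)" using stable_closure_cover stable_set_B[OF g(1)] by blast
  then obtain h where h: "h \<in> stable_set (dl l)" "h n = g n" unfolding stable_closure_def by blast
  then have "h \<in> stable_set (dl k)" unfolding stable_set_def using g(2) stable_set_B[OF h(1)] h(2) by (intro CollectI conjI exI[of _ n]) auto
  with h(1) have "k = l" using stable_set_disjoint[of k l] by blast
  with l show ?thesis by simp
qed

end

end

section \<open>The boundary of a Toeplitz window\<close>

locale toeplitz = 
  fixes p :: "nat \<Rightarrow> nat" and \<eta> :: "int \<Rightarrow> bool"
  assumes toeplitz: "nonperiodic_toeplitz p \<eta>"

sublocale toeplitz \<subseteq> odometer_group p
  using toeplitz unfolding nonperiodic_toeplitz_def by unfold_locales blast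

context toeplitz
begin

abbreviation "B \<equiv> bdW p \<eta>"

lemma coset_cong: "[k = k'] (mod int q) \<Longrightarrow> coset k q = coset k' q"
  unfolding cong_def by (simp add: set_eq_iff coset_iff)

lemma Per_cong: "[k = k'] (mod int (p n)) \<Longrightarrow> k \<in> Per p \<eta> n i \<longleftrightarrow> k' \<in> Per p \<eta> n i"
  unfolding Per_def using coset_cong by simp

lemma holes_cong: "[k = k'] (mod int (p n)) \<Longrightarrow> k \<in> holes p \<eta> n \<longleftrightarrow> k' \<in> holes p \<eta> n"
  unfolding holes_def using Per_cong by simp

lemma holes_antimono:
  assumes "n \<le> m"
  shows "holes p \<eta> m \<subseteq> holes p \<eta> n"
proof -
  have "coset k (p m) \<subseteq> coset k (p n)" for k
    using p_dvd[OF assms] unfolding coset_def by (auto simp: dvd_def mult.assoc)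
  then have "Per p \<eta> n i \<subseteq> Per p \<eta> m i" for i unfolding Per_def by blast
  then show ?thesis unfolding holes_def by blast
qed

lemma eventually_not_hole: "\<exists>n. k \<notin> holes p \<eta> n"
proof -
  obtain n where "\<eta> constant_on coset k (p n)"
    using toeplitz unfolding nonperiodic_toeplitz_def by blast
  then obtain i where "\<forall>l\<in>coset k (p n). \<eta> l = i" unfolding constant_on_def by blast
  then have "k \<in> Per p \<eta> n i" by (simp add: Per_def)
  then show ?thesis unfolding holes_def by (cases i) auto
qed

lemma essential_holes_cong:
  assumes "x \<in> essential_holes p \<eta> n" "[x = y] (mod int (p n))"
  shows "y \<in> essential_holes p \<eta> n"
  using assms holes_cong[OF assms(2)] coset_cong[OF assms(2)] by (simp add: essential_holes_def)

lemma mem_bdW_iff: "g \<in> B \<longleftrightarrow> g \<in> G \<and> (\<forall>n. g n \<in> holes p \<eta> n)"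
  unfolding bdW_eq[OF toeplitz] holes_def by (auto simp: mem_V_iff)

lemma bdW_subset: "B \<subseteq> G"
  using mem_bdW_iff by blast

lemma bdW_closed:
  assumes "h \<in> G" "\<And>n. \<exists>g\<in>B. g n = h n"
  shows "h \<in> B"
  unfolding mem_bdW_iff using assms mem_bdW_iff by metis

text \<open>The higher coordinates of g are themselves the required holes in the class of
  \<open>g N\<close>.\<close>

lemma bdW_essential:
  assumes "g \<in> B"
  shows "g N \<in> essential_holes p \<eta> N"
proof -
  have g: "g \<in> G" "\<And>n. g n \<in> holes p \<eta> n" using assms mem_bdW_iff by auto
  have "g n \<in> coset (g N) (p N)" if "n \<ge> N" for n
    using odometer_mod[OF period g(1) that] mod_p[OF g(1)] by (simp add: coset_iff)
  with g(2) show ?thesis unfolding essential_holes_def by blast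
qed

lemma Delta_in_cyl: "Delta p l n = g n \<longleftrightarrow> l \<in> coset (g n) (p n)" if "g \<in> G"
  using mod_p[OF that] by (simp add: Delta_def coset_iff)

text \<open>The holes at later levels in the class of c make the closed sets \<open>C n\<close>
  nonempty; these decrease because a hole at one level is a hole at all lower ones. Compactness
  gives a common point, all of whose coordinates are holes.\<close>

lemma essential_hole_lift:
  assumes compact: "compact_space (top_of_set G)" and c: "c \<in> essential_holes p \<eta> N"
  obtains g where "g \<in> B" "g N = c mod int (p N)"
proof -
  define C where "C n = {g \<in> G. g N = c mod int (p N) \<and> g (n + N) \<in> holes p \<eta> (n + N)}" for n
  have "closedin (top_of_set G) (C n)" for n
    unfolding C_def by (subst closedin_odometer_iff) (auto, metis+)
  moreover have "C n \<noteq> {}" for n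
  proof -
    obtain k where k: "k \<in> holes p \<eta> (n + N)" "k \<in> coset c (p N)"
      using c unfolding essential_holes_def by (auto dest!: spec[of _ "n + N"])
    have "[k = k mod int (p (n + N))] (mod int (p (n + N)))" by (simp add: cong_def)
    then have "k mod int (p (n + N)) \<in> holes p \<eta> (n + N)" using holes_cong k(1) by blast
    then have "Delta p k \<in> C n" using k(2) Delta_mem[of k] unfolding C_def
      by (simp add: Delta_def coset_iff)
    then show ?thesis by blast
  qed
  moreover have "decseq C"
  proof (rule decseq_SucI, rule subsetI)
    fix n g assume g: "g \<in> C (Suc n)"
    then have "g (Suc n + N) \<in> holes p \<eta> (n + N)" "g \<in> G"
      using holes_antimono[of "n + N" "Suc n + N"] unfolding C_def by auto
    moreover from this have "[g (Suc n + N) = g (n + N)] (mod int (p (n + N)))"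
      using cong_Suc[of g "n + N"] by simp
    ultimately have "g (n + N) \<in> holes p \<eta> (n + N)" using holes_cong by blast
    with g show "g \<in> C n" unfolding C_def by simp
  qed
  ultimately have "(\<Inter>n. C n) \<noteq> {}" using compact_space_imp_nest[OF compact] by blast
  then obtain g where g: "\<And>n. g \<in> C n" by blast
  have gG: "g \<in> G" and gN: "g N = c mod int (p N)" using g[of 0] unfolding C_def by auto
  have "g n \<in> holes p \<eta> n" for n
  proof -
    have "g (n + N) \<in> holes p \<eta> n" using g[of n] holes_antimono[of n "n + N"] unfolding C_def by auto
    moreover have "[g (n + N) = g n] (mod int (p n))"
      using odometer_mod[OF period gG, of n "n + N"] mod_p[OF gG] by (simp add: cong_def)
    ultimately show ?thesis using holes_cong by blast
  qed
  with gG gN that show ?thesis unfolding mem_bdW_iff by blast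
qed

lemma bdW_rigid:
  fixes A :: "nat \<Rightarrow> nat set" and S :: "nat \<Rightarrow> nat \<Rightarrow> nat set"
  assumes compact: "compact_space (top_of_set G)"
    and A_pos: "\<And>n a. a \<in> A n \<Longrightarrow> a > 0"
    and ess: "\<And>n. essential_holes p \<eta> n = (\<Union>a\<in>A n. multiples {a} - multiples (S n a))"
    and nonempty: "\<And>n a. a \<in> A n \<Longrightarrow> multiples {a} - multiples (S n a) \<noteq> {}"
    and lim: "\<And>a. (\<And>n. a n \<in> A n) \<Longrightarrow>
       (\<lambda>n. \<Sum>\<^sub>\<infinity>a'\<in>A n - {a n}. ennreal (1 / real (totient (a' div gcd a' (a n))))) \<longlonglongrightarrow> 0"
    and k: "k \<noteq> 0" and \<beta>: "\<beta> \<in> G" and h: "h \<in> B"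
  shows "\<exists>g\<in>B. g N = h N \<and> \<not> (g \<oplus> \<beta> \<in> B \<and> g \<oplus> od_mult p 2 \<beta> \<oplus> Delta p k \<in> B)"
proof (rule ccontr)
  assume "\<not> ?thesis"
  then have *: "g \<oplus> \<beta> \<in> B" "g \<oplus> od_mult p 2 \<beta> \<oplus> Delta p k \<in> B" if "g \<in> B" "g N = h N" for g
    using that by blast+
  define \<epsilon> where "\<epsilon> = 1 / (4 * real (p N) ^ 2)"
  have eps: "\<epsilon> > 0" unfolding \<epsilon>_def using p_pos[of N] by simp
  have cover: "hole_cover (essential_holes p \<eta> n) (A n) (S n) (p n)" for n
    by (rule hole_cover.intro[OF p_pos essential_holes_cong A_pos ess nonempty])
  have A_ne: "A n \<noteq> {}" for n using bdW_essential[OF h, of n] unfolding ess by blast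
  \<comment> \<open>Picking a bad generator at every level that has one lets a single instance of
    the limit hypothesis rule out all bad generators from some level on.\<close>
  define bad where "bad n a \<longleftrightarrow> a \<in> A n \<and> (\<exists>F. finite F \<and> F \<subseteq> A n - {a} \<and> sum (weight a) F > \<epsilon>)" for n a
  define a where "a n = (if \<exists>a. bad n a then SOME a. bad n a else SOME a. a \<in> A n)" for n
  have bad_a: "bad n (a n)" if "bad n b" for n b
    unfolding a_def using someI_ex[of "bad n"] that by auto
  have a_mem: "a n \<in> A n" for n
  proof (cases "\<exists>b. bad n b")
    case True
    then show ?thesis using bad_a unfolding bad_def by blast
  next
    case False
    then have "a n = (SOME a. a \<in> A n)" unfolding a_def by (simp only: if_False)
    then show ?thesis using A_ne[of n] by (simp add: some_in_eq)
  qed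
  have "\<forall>\<^sub>F n in sequentially. (\<Sum>\<^sub>\<infinity>a'\<in>A n - {a n}. ennreal (1 / real (totient (a' div gcd a' (a n))))) < ennreal \<epsilon>"
    using order_tendstoD(2)[OF lim[of a, OF a_mem]] eps by simp
  then obtain n1 where n1: "\<And>n. n \<ge> n1 \<Longrightarrow>
      (\<Sum>\<^sub>\<infinity>a'\<in>A n - {a n}. ennreal (weight (a n) a')) < ennreal \<epsilon>"
    unfolding eventually_sequentially weight_def by blast
  have small: "sum (weight b) F \<le> \<epsilon>" if "n \<ge> n1" "b \<in> A n" "finite F" "F \<subseteq> A n - {b}" for n b F
  proof (rule ccontr)
    assume "\<not> sum (weight b) F \<le> \<epsilon>"
    then have "bad n b" using that unfolding bad_def by (intro conjI exI[of _ F]) auto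
    then have "bad n (a n)" by (rule bad_a)
    then obtain F' where F': "finite F'" "F' \<subseteq> A n - {a n}" "sum (weight (a n)) F' > \<epsilon>"
      unfolding bad_def by blast
    have "ennreal \<epsilon> \<le> ennreal (sum (weight (a n)) F')" using F'(3) by (simp add: ennreal_leI)
    also have "\<dots> = (\<Sum>a'\<in>F'. ennreal (weight (a n) a'))"
      by (rule sum_ennreal[symmetric]) (simp add: weight_def)
    also have "\<dots> \<le> (\<Sum>\<^sub>\<infinity>a'\<in>A n - {a n}. ennreal (weight (a n) a'))"
      using F'(1,2) by (subst nonneg_infsum_complete) (auto intro!: SUP_upper)
    finally show False using n1[OF that(1)] by simp
  qed
  obtain f where f: "\<And>a. a \<notin> holes p \<eta> (f a)" using eventually_not_hole by metis
  \<comment> \<open>The level is so deep that, besides the smallness of the sums, none of 1, ...,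
    |k| is a hole any more.\<close>
  define n where "n = Max (insert N (insert n1 (f ` {1..\<bar>k\<bar>})))"
  have n: "n \<ge> N" "n \<ge> n1" "\<And>a. a \<in> {1..\<bar>k\<bar>} \<Longrightarrow> n \<ge> f a"
    unfolding n_def by (rule Max_ge; simp)+
  have not_hole: "a \<notin> holes p \<eta> n" if "a \<in> {1..\<bar>k\<bar>}" for a
    using holes_antimono[OF n(3)[OF that]] f by blast
  interpret hole_cover "essential_holes p \<eta> n" "A n" "S n" "p n" by (rule cover)
  have hG: "h \<in> G" using h bdW_subset by blast
  have h0: "int (nat (h n)) = h n" using hG unfolding odometer_def by simp
  \<comment> \<open>Such an x lifts to a boundary point in the cylinder of h at level N, to which
    the inclusions assumed for contradiction apply.\<close>
  have tr: "x + \<beta> n \<in> essential_holes p \<eta> n \<and> x + (2 * \<beta> n + k) \<in> essential_holes p \<eta> n"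
    if x: "x \<in> essential_holes p \<eta> n" "[x = int (nat (h n))] (mod int (p N))" for x
  proof -
    obtain g where g: "g \<in> B" "g n = x mod int (p n)" using essential_hole_lift[OF compact x(1)] by blast
    then have "g N = x mod int (p n) mod int (p N)"
      using odometer_mod[OF period _ n(1), of g] bdW_subset by (metis subsetD)
    also have "\<dots> = x mod int (p N)" using p_dvd[OF n(1)] by (simp add: mod_mod_cancel)
    also have "\<dots> = h n mod int (p N)" using x(2) h0 by (simp add: cong_def)
    also have "\<dots> = h N" by (rule odometer_mod[OF period hG n(1)])
    finally have gN: "g N = h N" .
    have "[(g \<oplus> \<beta>) n = x + \<beta> n] (mod int (p n))"
      using g(2) by (simp add: od_defs cong_def mod_simps)
    moreover have "[(g \<oplus> od_mult p 2 \<beta> \<oplus> Delta p k) n = x + (2 * \<beta> n + k)] (mod int (p n))"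
      using g(2) by (simp add: od_defs cong_def mod_simps add.assoc)
    ultimately show ?thesis
      using bdW_essential[OF *(1)[OF g(1) gN], of n] bdW_essential[OF *(2)[OF g(1) gN], of n]
        essential_holes_cong by blast
  qed
  have "int (nat (h n)) \<in> essential_holes p \<eta> n" using bdW_essential[OF h] h0 by simp
  then obtain b where b: "b \<in> A n" "int b dvd \<beta> n" "int b dvd 2 * \<beta> n + k"
    using common_generator_dvd[OF p_dvd[OF n(1)], of "nat (h n)" "\<beta> n" "2 * \<beta> n + k"]
      small[OF n(2)] tr unfolding \<epsilon>_def by blast
  then have "int b dvd k" by (metis dvd_add_right_iff dvd_mult)
  then have "int b \<le> \<bar>k\<bar>" using k by (simp add: zdvd_imp_le dvd_imp_le_int)
  moreover have "int b \<ge> 1" using A_pos[OF b(1)] by simp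
  ultimately have "int b \<notin> holes p \<eta> n" by (intro not_hole) simp
  then show False using generator_mem[OF b(1)] by (simp add: essential_holes_def)
qed

end

section \<open>Automorphisms and block codes\<close>

definition translate :: "(int \<Rightarrow> bool) \<Rightarrow> int \<Rightarrow> int \<Rightarrow> bool" where
  "translate x k = (\<lambda>i. x (i + k))"

lemma translate_mem: "translate \<eta> k \<in> orbit_closure \<eta>"
  unfolding orbit_closure_def translate_def by (rule subsetD[OF closure_subset]) blast

lemma shift_translate: "shift (translate x k) = translate x (k + 1)"
  unfolding shift_def translate_def by (simp add: add_ac)

lemma orbit_dense:
  assumes "openin (top_of_set (orbit_closure \<eta>)) U" "x \<in> U"
  obtains k where "translate \<eta> k \<in> U"
proof -
  obtain O' where O': "open O'" "U = orbit_closure \<eta> \<inter> O'" using assms(1) by (auto simp: openin_open)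
  have "x \<in> closure {\<lambda>i. \<eta> (i + k) |k. True}" "x \<in> O'"
    using O' assms(2) unfolding orbit_closure_def by blast+
  then obtain k where "(\<lambda>i. \<eta> (i + k)) \<in> O'"
    using O'(1) open_Int_closure_eq_empty[of O' "{\<lambda>i. \<eta> (i + k) |k. True}"] by blast
  then have "translate \<eta> k \<in> U" unfolding O'(2) translate_def[symmetric] using translate_mem by blast
  then show ?thesis by (rule that)
qed

lemma openin_coord: "openin (top_of_set X) {x \<in> X. x s = b}" for X :: "('i \<Rightarrow> 'b::discrete_topology) set"
proof -
  have "open ((\<lambda>x :: 'i \<Rightarrow> 'b. x s) -` {b})"
    by (intro open_vimage continuous_on_product_coordinates open_discrete)
  moreover have "{x \<in> X. x s = b} = X \<inter> (\<lambda>x. x s) -` {b}" by blast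
  ultimately show ?thesis by (metis openin_open_Int)
qed

lemma closedin_coord: "closedin (top_of_set X) {x \<in> X. x s = b}" for X :: "('i \<Rightarrow> 'b::discrete_topology) set"
proof -
  have "closed ((\<lambda>x :: 'i \<Rightarrow> 'b. x s) -` {b})"
    by (intro closed_vimage continuous_on_product_coordinates) (simp add: closed_def open_discrete)
  moreover have "{x \<in> X. x s = b} = X \<inter> (\<lambda>x. x s) -` {b}" by blast
  ultimately show ?thesis by (metis closedin_closed_Int)
qed

lemma compact_orbit_closure: "compact_space (top_of_set (orbit_closure \<eta>))"
proof -
  have "compact_space (euclidean :: bool topology)"
    unfolding compact_space_def by (rule finite_imp_compactin) simp_all
  then have "compact_space (euclidean :: (int \<Rightarrow> bool) topology)"
    unfolding euclidean_product_topology[symmetric] compact_space_product_topology by blast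
  moreover have "closedin euclidean (orbit_closure \<eta>)" unfolding orbit_closure_def by simp
  ultimately show ?thesis by (intro compact_space_subtopology closedin_compact_space)
qed

locale toeplitz_factor = toeplitz +
  fixes \<pi> :: "(int \<Rightarrow> bool) \<Rightarrow> nat \<Rightarrow> int"
  assumes factor: "factor_map (top_of_set (orbit_closure \<eta>)) shift (top_of_set (odometer p)) (od_step p) \<pi>"
    and pi_eta: "\<pi> \<eta> = Delta p 0"
begin

abbreviation "X \<equiv> orbit_closure \<eta>"

lemma pi_mem: "x \<in> X \<Longrightarrow> \<pi> x \<in> G"
  using factor unfolding factor_map_def by auto

lemma openin_pi_coord:
  assumes "continuous_map (top_of_set X) (top_of_set G) f"
  shows "openin (top_of_set X) {x \<in> X. f x n = c}"
proof -
  have "openin (top_of_set X) {x \<in> topspace (top_of_set X). f x \<in> {g \<in> G. g n = c}}"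
    using assms openin_coord by (rule openin_continuous_map_preimage)
  moreover have "{x \<in> topspace (top_of_set X). f x \<in> {g \<in> G. g n = c}} = {x \<in> X. f x n = c}"
    using assms by (auto simp: continuous_map_def)
  ultimately show ?thesis by simp
qed

text \<open>Stated for any equivariant map because it is applied both to \<pi> and to \<pi> after
  F.\<close>

lemma equivariant_translate:
  assumes "\<And>x. x \<in> X \<Longrightarrow> f x \<in> G" "\<And>x. x \<in> X \<Longrightarrow> f (shift x) = f x \<oplus> Delta p 1"
  shows "f (translate \<eta> k) = f \<eta> \<oplus> Delta p k"
proof (induction k rule: int_induct[of _ 0])
  case base
  have "translate \<eta> 0 = \<eta>" by (simp add: translate_def)
  then show ?case using assms(1)[OF translate_mem[of \<eta> 0]] plus_Delta_0 by simp
next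
  case (step1 i)
  have e: "\<eta> \<in> X" using translate_mem[of \<eta> 0] by (simp add: translate_def)
  have "f (translate \<eta> (i + 1)) = f \<eta> \<oplus> Delta p i \<oplus> Delta p 1"
    using assms(2)[OF translate_mem[of \<eta> i]] step1 by (simp add: shift_translate)
  also have "\<dots> = f \<eta> \<oplus> Delta p (i + 1)"
    by (rule od_eqI, use assms(1)[OF e] in simp, use assms(1)[OF e] in simp,
        simp only: od_defs cong_def mod_simps, simp add: algebra_simps)
  finally show ?case .
next
  case (step2 i)
  have i: "f \<eta> \<oplus> Delta p i = f (translate \<eta> (i - 1)) \<oplus> Delta p 1"
    using assms(2)[OF translate_mem[of \<eta> "i - 1"]] step2 by (simp add: shift_translate)
  have e: "\<eta> \<in> X" using translate_mem[of \<eta> 0] by (simp add: translate_def)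
  have "f (translate \<eta> (i - 1)) = f (translate \<eta> (i - 1)) \<oplus> Delta p 1 \<oplus> Delta p (- 1)"
    by (rule od_eqI, use assms(1)[OF translate_mem] in simp, use assms(1)[OF translate_mem] in simp,
        simp only: od_defs cong_def mod_simps, simp add: algebra_simps)
  also have "\<dots> = f \<eta> \<oplus> Delta p i \<oplus> Delta p (- 1)" by (simp only: i)
  also have "\<dots> = f \<eta> \<oplus> Delta p (i - 1)"
    by (rule od_eqI, use assms(1)[OF e] in simp, use assms(1)[OF e] in simp,
        simp only: od_defs cong_def mod_simps, simp add: algebra_simps)
  finally show ?case .
qed

lemma pi_shift: "x \<in> X \<Longrightarrow> \<pi> (shift x) = \<pi> x \<oplus> Delta p 1"
  using factor unfolding factor_map_def od_step_def by simp

lemma pi_translate: "\<pi> (translate \<eta> k) = Delta p k"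
proof -
  have "\<pi> (translate \<eta> k) = Delta p 0 \<oplus> Delta p k"
    using equivariant_translate[of \<pi>] pi_mem pi_shift pi_eta by simp
  also have "\<dots> = Delta p k" by (rule ext) (simp add: od_defs)
  finally show ?thesis .
qed

lemma pi_continuous: "continuous_map (top_of_set X) (top_of_set G) \<pi>"
  using factor unfolding factor_map_def by blast

text \<open>Some translate of \<eta> has the same symbol at s as x and the same image at level n;
  the position of \<eta> read there lies in a class on which \<eta> is constantly i.\<close>

lemma value_of_V:
  assumes x: "x \<in> X" and V: "\<pi> x \<oplus> Delta p s \<in> V p \<eta> i"
  shows "x s = i"
proof -
  obtain n where n: "(\<pi> x \<oplus> Delta p s) n \<in> Per p \<eta> n i" using V unfolding mem_V_iff by blast
  have "openin (top_of_set X) ({x' \<in> X. x' s = x s} \<inter> {x' \<in> X. \<pi> x' n = \<pi> x n})"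
    by (intro openin_Int openin_coord openin_pi_coord pi_continuous)
  then obtain k where k: "translate \<eta> k \<in> {x' \<in> X. x' s = x s} \<inter> {x' \<in> X. \<pi> x' n = \<pi> x n}"
    using x by (elim orbit_dense[where x = x]) auto
  then have "\<pi> x n = k mod int (p n)" "\<eta> (s + k) = x s"
    using pi_translate[of k] by (auto simp: translate_def Delta_def)
  then have "s + k \<in> coset ((\<pi> x \<oplus> Delta p s) n) (p n)"
    by (simp add: coset_iff od_defs mod_simps add.commute)
  with n have "\<eta> (s + k) = i" unfolding Per_def by blast
  with \<open>\<eta> (s + k) = x s\<close> show ?thesis by simp
qed

text \<open>As \<open>g n\<close> is a hole, its class contains a position where \<eta> has the
  value i, and translating \<eta> to it makes each \<open>C n\<close> nonempty. Compactness of the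
  orbit closure gives a common point.\<close>

lemma boundary_lift:
  assumes g: "g \<in> B"
  obtains x where "x \<in> X" "\<pi> x = g" "x 0 = i"
proof -
  have gG: "g \<in> G" using g bdW_subset by blast
  define C where "C n = {x \<in> X. x 0 = i} \<inter> {x \<in> X. \<pi> x n = g n}" for n
  have cl: "closedin (top_of_set X) (C n)" for n
  proof -
    have "closedin (top_of_set X) {x \<in> topspace (top_of_set X). \<pi> x \<in> {h \<in> G. h n = g n}}"
      using pi_continuous closedin_coord by (rule closedin_continuous_map_preimage)
    moreover have "{x \<in> topspace (top_of_set X). \<pi> x \<in> {h \<in> G. h n = g n}} = {x \<in> X. \<pi> x n = g n}"
      using pi_mem by auto
    ultimately show ?thesis unfolding C_def by (intro closedin_Int closedin_coord) simp
  qed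
  have ne: "C n \<noteq> {}" for n
  proof -
    have "g n \<notin> Per p \<eta> n (\<not> i)" using g unfolding mem_bdW_iff holes_def by (cases i) auto
    then obtain l where l: "l \<in> coset (g n) (p n)" "\<eta> l = i" unfolding Per_def by auto
    then have "translate \<eta> l \<in> C n"
      unfolding C_def using translate_mem[of \<eta> l] pi_translate[of l] Delta_in_cyl[OF gG]
      by (simp add: translate_def)
    then show ?thesis by blast
  qed
  have "decseq C"
  proof (rule decseq_SucI, rule subsetI)
    fix n x assume x: "x \<in> C (Suc n)"
    then have "\<pi> x n = g n" using cyl_mono[of "\<pi> x" g "Suc n" n] pi_mem gG unfolding C_def by auto
    with x show "x \<in> C n" unfolding C_def by simp
  qed
  then have "(\<Inter>n. C n) \<noteq> {}"
    by (rule compact_space_imp_nest[OF compact_orbit_closure cl ne])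
  then obtain x where x: "\<And>n. x \<in> C n" by blast
  have "\<pi> x n = g n" for n using x[of n] unfolding C_def by blast
  moreover have "x \<in> X" "x 0 = i" using x[of 0] unfolding C_def by blast+
  ultimately show ?thesis by (intro that[of x] ext)
qed

text \<open>The continuous maps \<pi> after F and \<pi> + \<pi>(F(\<eta>)) agree on the dense orbit
  of \<eta>. Evaluation at \<eta> gives the uniqueness that \<open>THE\<close> in
  \<open>y_of\<close> requires.\<close>

lemma automorphism_translation:
  assumes F: "automorphism X F"
  shows "y_of p X \<pi> F \<in> G" and "\<And>x. x \<in> X \<Longrightarrow> \<pi> (F x) = \<pi> x \<oplus> y_of p X \<pi> F"
proof -
  have hom: "homeomorphic_map (top_of_set X) (top_of_set X) F"
    and comm: "\<And>x. x \<in> X \<Longrightarrow> F (shift x) = shift (F x)"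
    using F unfolding automorphism_def by blast+
  have FX: "F x \<in> X" if "x \<in> X" for x
    using homeomorphic_imp_surjective_map[OF hom] that by auto
  have e: "\<eta> \<in> X" using translate_mem[of \<eta> 0] by (simp add: translate_def)
  define y where "y = \<pi> (F \<eta>)"
  have y: "y \<in> G" unfolding y_def using pi_mem FX e by blast
  have cont: "continuous_map (top_of_set X) (top_of_set G) (\<pi> \<circ> F)"
    using homeomorphic_imp_continuous_map[OF hom] pi_continuous by (rule continuous_map_compose)
  have trF: "(\<pi> \<circ> F) (translate \<eta> k) = y \<oplus> Delta p k" for k
    using equivariant_translate[of "\<pi> \<circ> F" k] pi_mem FX comm pi_shift by (simp add: y_def)
  have main: "\<pi> (F x) = \<pi> x \<oplus> y" if x: "x \<in> X" for x
  proof (rule ext)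
    fix n
    have "openin (top_of_set X) ({x' \<in> X. (\<pi> \<circ> F) x' n = (\<pi> \<circ> F) x n} \<inter> {x' \<in> X. \<pi> x' n = \<pi> x n})"
      by (intro openin_Int openin_pi_coord cont pi_continuous)
    then obtain k where "translate \<eta> k \<in> {x' \<in> X. (\<pi> \<circ> F) x' n = (\<pi> \<circ> F) x n} \<inter> {x' \<in> X. \<pi> x' n = \<pi> x n}"
      using x by (elim orbit_dense[where x = x]) auto
    then have "(y \<oplus> Delta p k) n = \<pi> (F x) n" "Delta p k n = \<pi> x n"
      using trF[of k] pi_translate[of k] by auto
    then show "\<pi> (F x) n = (\<pi> x \<oplus> y) n" by (simp add: od_add_def add.commute)
  qed
  have "y_of p X \<pi> F = y"
    unfolding y_of_def
  proof (rule the_equality)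
    fix z assume z: "z \<in> G \<and> (\<forall>x\<in>X. \<pi> (F x) = \<pi> x \<oplus> z)"
    then have "y = Delta p 0 \<oplus> z" using e pi_eta unfolding y_def by metis
    also have "\<dots> = z" by (rule ext) (use z in \<open>simp add: od_defs mod_p\<close>)
    finally show "z = y" by simp
  qed (use y main in blast)
  with y main show "y_of p X \<pi> F \<in> G" "\<And>x. x \<in> X \<Longrightarrow> \<pi> (F x) = \<pi> x \<oplus> y_of p X \<pi> F" by simp_all
qed

lemma boundary_cover:
  assumes F: "automorphism X F" and code: "described_by X F m c" and g: "g \<in> B"
  shows "\<exists>s\<in>{- int m..int m}. g \<oplus> (od_mult p (- 1) (y_of p X \<pi> F) \<oplus> Delta p s) \<in> B"
proof -
  define y where "y = y_of p X \<pi> F"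
  have y: "y \<in> G" "\<And>x. x \<in> X \<Longrightarrow> \<pi> (F x) = \<pi> x \<oplus> y"
    using automorphism_translation[OF F] unfolding y_def by blast+
  have surj: "F ` X = X"
    using F homeomorphic_imp_surjective_map[of "top_of_set X" "top_of_set X" F]
    unfolding automorphism_def by simp
  have gG: "g \<in> G" using g bdW_subset by blast
  have "\<exists>z\<in>X. \<pi> z = g \<oplus> od_mult p (- 1) y \<and> F z 0 = i" for i
  proof -
    obtain x where x: "x \<in> X" "\<pi> x = g" "x 0 = i" by (rule boundary_lift[OF g])
    from x(1) have "x \<in> F ` X" by (simp only: surj)
    then obtain z where z: "z \<in> X" "F z = x" by blast
    have zG: "\<pi> z \<in> G" using pi_mem z(1) by blast
    have "\<pi> z = \<pi> z \<oplus> y \<oplus> od_mult p (- 1) y"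
      by (rule od_eqI, use zG y(1) in simp, use zG y(1) in simp,
          simp only: od_defs cong_def mod_simps, simp add: algebra_simps)
    also have "\<pi> z \<oplus> y = g" using y(2)[OF z(1)] z(2) x(2) by simp
    finally show ?thesis using z x(3) by blast
  qed
  then obtain z0 z1 where z0: "z0 \<in> X" "\<pi> z0 = g \<oplus> od_mult p (- 1) y" "F z0 0 = False"
    and z1: "z1 \<in> X" "\<pi> z1 = g \<oplus> od_mult p (- 1) y" "F z1 0 = True" by metis
  have "c (map z0 [- int m..int m]) \<noteq> c (map z1 [- int m..int m])"
    using code z0 z1 unfolding described_by_def by (metis add_0 diff_0)
  then have "map z0 [- int m..int m] \<noteq> map z1 [- int m..int m]" by metis
  then obtain s where s: "s \<in> {- int m..int m}" "z0 s \<noteq> z1 s"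
    unfolding map_eq_conv set_upto by blast
  define g' where "g' = g \<oplus> od_mult p (- 1) y \<oplus> Delta p s"
  have g': "g' \<in> G" unfolding g'_def using gG y(1) by simp
  \<comment> \<open>Otherwise \<open>z0\<close> and \<open>z1\<close> would both have the symbol i
    at s.\<close>
  have "g' \<notin> V p \<eta> i" for i
    using value_of_V[OF z0(1), of s i] value_of_V[OF z1(1), of s i] z0(2) z1(2) s(2) unfolding g'_def by auto
  then have "g' \<in> B" unfolding bdW_eq[OF toeplitz] using g' by blast
  moreover have "g' = g \<oplus> (od_mult p (- 1) y \<oplus> Delta p s)"
    unfolding g'_def using gG y(1) by (simp add: plus_assoc)
  ultimately show ?thesis using s(1) unfolding y_def by blast
qed

end

section \<open>Translates of the boundary as conditions on points\<close>

lemma (in odometer_group) mem_image_diff: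
  assumes "C \<subseteq> G" "\<beta> \<in> G"
  shows "x \<in> (\<lambda>g. od_diff p g \<beta>) ` C \<longleftrightarrow> x \<in> G \<and> x \<oplus> \<beta> \<in> C"
proof safe
  fix g assume g: "g \<in> C"
  then have gG: "g \<in> G" using assms(1) by blast
  show "od_diff p g \<beta> \<in> G" using gG assms(2) by simp
  have "od_diff p g \<beta> \<oplus> \<beta> = g"
    by (rule od_eqI, use gG assms(2) in simp, rule gG,
        simp only: od_defs cong_def mod_simps, simp add: algebra_simps)
  with g show "od_diff p g \<beta> \<oplus> \<beta> \<in> C" by simp
next
  assume x: "x \<in> G" "x \<oplus> \<beta> \<in> C"
  have "x = od_diff p (x \<oplus> \<beta>) \<beta>"
    by (rule od_eqI, rule x(1), use x(1) assms(2) in simp,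
        simp only: od_defs cong_def mod_simps, simp add: algebra_simps)
  with x(2) show "x \<in> (\<lambda>g. od_diff p g \<beta>) ` C" by blast
qed

context rigid_set
begin

lemma nowhere_denseI:
  assumes "D \<subseteq> B"
    and closed: "\<And>h. h \<in> B \<Longrightarrow> (\<And>n. \<exists>g\<in>D. g n = h n) \<Longrightarrow> h \<in> D"
    and sparse: "\<And>h n. h \<in> B \<Longrightarrow> \<exists>g\<in>B. g n = h n \<and> g \<notin> D"
  shows "nowhere_dense_in (top_of_set B) D"
proof -
  have "closedin (top_of_set B) D"
    using closed unfolding closedin_odometer_iff[OF B_subset assms(1)] by blast
  then have "top_of_set B closure_of D = D" by (rule closure_of_closedin)
  moreover have "top_of_set B interior_of D = {}"
    using sparse unfolding interior_of_odometer[OF B_subset assms(1)] by blast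
  ultimately show ?thesis unfolding nowhere_dense_in_def using assms(1) by simp
qed

text \<open>The set is closed by continuity of the translations and has empty interior by
  \<open>rigid\<close>, once the two successive subtractions are merged into one.\<close>

lemma nowhere_dense_progression:
  assumes k: "k \<noteq> 0" and \<beta>: "\<beta> \<in> G"
  shows "nowhere_dense_in (top_of_set B)
    (B \<inter> (\<lambda>g. od_diff p g \<beta>) ` B \<inter> (\<lambda>g. od_diff p (od_diff p g (od_mult p 2 \<beta>)) (Delta p k)) ` B)"
proof -
  let ?\<gamma> = "od_mult p 2 \<beta> \<oplus> Delta p k"
  have \<gamma>: "?\<gamma> \<in> G" using \<beta> by simp
  have img: "(\<lambda>g. od_diff p (od_diff p g (od_mult p 2 \<beta>)) (Delta p k)) ` B = (\<lambda>g. od_diff p g ?\<gamma>) ` B"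
  proof (rule image_cong[OF refl])
    fix g assume "g \<in> B"
    then have g: "g \<in> G" by (rule B_G)
    show "od_diff p (od_diff p g (od_mult p 2 \<beta>)) (Delta p k) = od_diff p g ?\<gamma>"
      by (rule od_eqI, use g \<beta> in simp, use g \<beta> in simp,
        simp only: od_defs cong_def mod_simps, simp add: algebra_simps)
  qed
  have eq: "B \<inter> (\<lambda>g. od_diff p g \<beta>) ` B \<inter> (\<lambda>g. od_diff p (od_diff p g (od_mult p 2 \<beta>)) (Delta p k)) ` B
      = {g \<in> B. g \<oplus> \<beta> \<in> B \<and> g \<oplus> ?\<gamma> \<in> B}" (is "_ = ?D")
    unfolding img set_eq_iff Int_iff mem_Collect_eq
      mem_image_diff[OF B_subset \<beta>] mem_image_diff[OF B_subset \<gamma>]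
    using B_G by blast
  show ?thesis
    unfolding eq
  proof (rule nowhere_denseI)
    fix h assume h: "h \<in> B" "\<And>n. \<exists>g\<in>?D. g n = h n"
    have "h \<oplus> \<beta> \<in> B" using h(2) by (intro plus_closed[OF \<beta> B_G[OF h(1)]]) blast
    moreover have "h \<oplus> ?\<gamma> \<in> B" using h(2) by (intro plus_closed[OF \<gamma> B_G[OF h(1)]]) blast
    ultimately show "h \<in> ?D" using h(1) by blast
  next
    fix h n assume "h \<in> B"
    then obtain g where g: "g \<in> B" "g n = h n"
      "\<not> (g \<oplus> \<beta> \<in> B \<and> g \<oplus> od_mult p 2 \<beta> \<oplus> Delta p k \<in> B)"
      using rigid[OF k \<beta>] by blast
    moreover have "g \<oplus> od_mult p 2 \<beta> \<oplus> Delta p k = g \<oplus> ?\<gamma>"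
      using B_G[OF g(1)] \<beta> by (simp add: plus_assoc)
    ultimately show "\<exists>g\<in>B. g n = h n \<and> g \<notin> ?D" by (intro bexI[of _ g]) simp_all
  qed blast
qed

lemma nowhere_dense_translate:
  assumes k: "k \<noteq> 0"
  shows "nowhere_dense_in (top_of_set B) (B \<inter> (\<lambda>g. od_diff p g (Delta p k)) ` B)"
proof -
  have eq: "B \<inter> (\<lambda>g. od_diff p g (Delta p k)) ` B = {g \<in> B. g \<oplus> Delta p k \<in> B}" (is "_ = ?D")
    unfolding set_eq_iff Int_iff mem_Collect_eq mem_image_diff[OF B_subset Delta_mem]
    using B_G by blast
  show ?thesis
    unfolding eq
  proof (rule nowhere_denseI)
    fix h assume h: "h \<in> B" "\<And>n. \<exists>g\<in>?D. g n = h n"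
    have "h \<oplus> Delta p k \<in> B" using h(2) by (intro plus_closed[OF Delta_mem B_G[OF h(1)]]) blast
    then show "h \<in> ?D" using h(1) by blast
  next
    fix h n assume "h \<in> B"
    then show "\<exists>g\<in>B. g n = h n \<and> g \<notin> ?D" using Delta_rigid[OF k, of h n] by blast
  qed blast
qed

text \<open>The closed pieces for -y are invariant under multiples of either sign, and -1 times -y +
  \<Delta>(l) is y - \<Delta>(l).\<close>

lemma cover_inverse:
  assumes L: "finite L" and y: "y \<in> G"
    and cov: "\<And>g. g \<in> B \<Longrightarrow> \<exists>l\<in>L. g \<oplus> (od_mult p (- 1) y \<oplus> Delta p l) \<in> B"
    and g: "g \<in> B"
  shows "\<exists>l\<in>L. g \<oplus> (y \<oplus> Delta p (- l)) \<in> B"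
proof -
  let ?\<delta> = "od_mult p (- 1) y"
  have \<delta>: "?\<delta> \<in> G" using y by simp
  obtain l where l: "l \<in> L" "g \<in> stable_closure (?\<delta> \<oplus> Delta p l)" using stable_closure_cover[OF L \<delta> cov g] by blast
  have "g \<oplus> od_mult p (- 1) (?\<delta> \<oplus> Delta p l) \<in> B"
    by (rule stable_closure_B[OF stable_closure_mult[OF L \<delta> cov l(2)]])
  moreover have "g \<oplus> od_mult p (- 1) (?\<delta> \<oplus> Delta p l) = g \<oplus> (y \<oplus> Delta p (- l))"
    by (rule od_eqI, use B_G[OF g] y in simp, use B_G[OF g] y in simp,
        simp only: od_defs cong_def mod_simps, simp add: algebra_simps)
  ultimately show ?thesis using l(1) by auto
qed

end

text \<open>The points of V_k are those that y - \<Delta>(k) moves into the boundary, so k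
  corresponds to the index -k of the stable sets.\<close>

lemma (in toeplitz) V_at_eq:
  assumes y: "y \<in> G"
  shows "V_at p \<eta> y k = {g \<in> B. g \<oplus> (y \<oplus> Delta p (- k)) \<in> B}"
proof -
  let ?\<gamma> = "y \<oplus> Delta p (- k)"
  have \<gamma>: "?\<gamma> \<in> G" using y by simp
  have img: "(\<lambda>g. od_diff p (g \<oplus> Delta p k) y) ` B = (\<lambda>g. od_diff p g ?\<gamma>) ` B"
  proof (rule image_cong[OF refl])
    fix g assume "g \<in> B"
    then have g: "g \<in> G" using bdW_subset by blast
    show "od_diff p (g \<oplus> Delta p k) y = od_diff p g ?\<gamma>"
      by (rule od_eqI, use g y in simp, use g y in simp,
        simp only: od_defs cong_def mod_simps, simp add: algebra_simps)
  qed
  show ?thesis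
    unfolding V_at_def img set_eq_iff Int_iff mem_Collect_eq mem_image_diff[OF bdW_subset \<gamma>]
    using bdW_subset by blast
qed

theorem proposition2p30:
  fixes p :: "nat \<Rightarrow> nat" and \<eta> :: "int \<Rightarrow> bool"
    and \<pi> :: "(int \<Rightarrow> bool) \<Rightarrow> nat \<Rightarrow> int"
    and A :: "nat \<Rightarrow> nat set" and S :: "nat \<Rightarrow> nat \<Rightarrow> nat set"
  assumes toeplitz: "nonperiodic_toeplitz p \<eta>"
    and mef: "max_equicontinuous_factor (top_of_set (orbit_closure \<eta>)) shift
                (top_of_set (odometer p)) (od_step p) \<pi>"
    and pi_eta: "\<pi> \<eta> = Delta p 0"
    and A_pos: "\<And>n a. a \<in> A n \<Longrightarrow> a > 0"
    and A_prim: "\<And>n. primitive (A n)"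
    and S_pos: "\<And>n a s. a \<in> A n \<Longrightarrow> s \<in> S n a \<Longrightarrow> s > 0"
    and ess: "\<And>n. essential_holes p \<eta> n = (\<Union>a\<in>A n. multiples {a} - multiples (S n a))"
    and nonempty: "\<And>n a. a \<in> A n \<Longrightarrow> multiples {a} - multiples (S n a) \<noteq> {}"
    and lim: "\<And>a. (\<And>n. a n \<in> A n) \<Longrightarrow>
       (\<lambda>n. \<Sum>\<^sub>\<infinity>a'\<in>A n - {a n}. ennreal (1 / real (totient (a' div gcd a' (a n)))))
         \<longlonglongrightarrow> 0"
  shows "(\<forall>k \<beta>. k \<noteq> 0 \<and> \<beta> \<in> odometer p \<longrightarrow>
            nowhere_dense_in (top_of_set (bdW p \<eta>))
              (bdW p \<eta> \<inter> (\<lambda>g. od_diff p g \<beta>) ` bdW p \<eta> \<inter>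
               (\<lambda>g. od_diff p (od_diff p g (od_mult p 2 \<beta>)) (Delta p k)) ` bdW p \<eta>)) \<and>
         (\<forall>k. k \<noteq> 0 \<longrightarrow>
            nowhere_dense_in (top_of_set (bdW p \<eta>))
              (bdW p \<eta> \<inter> (\<lambda>g. od_diff p g (Delta p k)) ` bdW p \<eta>)) \<and>
         (\<forall>F m c y. automorphism (orbit_closure \<eta>) F \<and> described_by (orbit_closure \<eta>) F m c \<and>
            y = y_of p (orbit_closure \<eta>) \<pi> F \<longrightarrow>
            K_set p \<eta> y \<subseteq> {- int m..int m} \<and>
            (\<forall>k\<in>K_set p \<eta> y. \<forall>l\<in>K_set p \<eta> y. k \<noteq> l \<longrightarrow>
               int_V_at p \<eta> y k \<inter> int_V_at p \<eta> y l = {}) \<and>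
            bdW p \<eta> = (\<Union>k\<in>K_set p \<eta> y. V'_at p \<eta> y k) \<and>
            (\<forall>k\<in>K_set p \<eta> y.
               {od_add p v (od_mult p j (od_diff p y (Delta p k))) |v j. v \<in> V'_at p \<eta> y k}
                 \<subseteq> V'_at p \<eta> y k))"
proof -
  interpret toeplitz p \<eta> by (rule toeplitz.intro[OF toeplitz])
  \<comment> \<open>The odometer is compact as the underlying space of an equicontinuous
    system.\<close>
  have compact: "compact_space (top_of_set G)"
    and factor: "factor_map (top_of_set (orbit_closure \<eta>)) shift (top_of_set (odometer p)) (od_step p) \<pi>"
    using mef unfolding max_equicontinuous_factor_def equicontinuous_system_def dyn_system_def by blast+
  interpret toeplitz_factor p \<eta> \<pi>
    by (intro toeplitz_factor.intro toeplitz_factor_axioms.intro toeplitz_axioms factor pi_eta)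
  interpret R: rigid_set p B
  proof
    show "B \<subseteq> odometer p" by (rule bdW_subset)
    show "h \<in> B" if "h \<in> odometer p" "\<And>n. \<exists>g\<in>B. g n = h n" for h
      using that by (rule bdW_closed)
    show "\<exists>g\<in>B. g n = h n \<and> \<not> (g \<oplus> \<beta> \<in> B \<and> g \<oplus> od_mult p 2 \<beta> \<oplus> Delta p k \<in> B)"
      if "k \<noteq> 0" "\<beta> \<in> odometer p" "h \<in> B" for k \<beta> h n
      by (rule bdW_rigid[OF compact A_pos ess nonempty lim that])
  qed
  have dynamics: "K_set p \<eta> y \<subseteq> {- int m..int m} \<and>
      (\<forall>k\<in>K_set p \<eta> y. \<forall>l\<in>K_set p \<eta> y. k \<noteq> l \<longrightarrow> int_V_at p \<eta> y k \<inter> int_V_at p \<eta> y l = {}) \<and>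
      B = (\<Union>k\<in>K_set p \<eta> y. V'_at p \<eta> y k) \<and>
      (\<forall>k\<in>K_set p \<eta> y. {v \<oplus> od_mult p j (od_diff p y (Delta p k)) |v j. v \<in> V'_at p \<eta> y k}
        \<subseteq> V'_at p \<eta> y k)"
    if F: "automorphism X F" and code: "described_by X F m c" and y_eq: "y = y_of p X \<pi> F" for F m c y
  proof -
    define L where "L = {- int m..int m}"
    \<comment> \<open>Symmetry of the window absorbs two changes of sign: the one in
      \<open>R.cover_inverse\<close> and the one between V_k and the stable sets.\<close>
    have L: "finite L" "\<And>l. l \<in> L \<longleftrightarrow> - l \<in> L" unfolding L_def by auto
    have y: "y \<in> G" unfolding y_eq using automorphism_translation(1)[OF F] .
    have cover: "\<exists>l\<in>L. g \<oplus> (y \<oplus> Delta p l) \<in> B" if "g \<in> B" for g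
      using R.cover_inverse[OF L(1) y _ that] boundary_cover[OF F code] L(2)
      unfolding y_eq L_def by blast
    have int_V: "int_V_at p \<eta> y k = R.stable_set (y \<oplus> Delta p (- k))" for k
      unfolding int_V_at_def V_at_eq[OF y]
      by (subst interior_of_odometer[OF bdW_subset]) (auto simp: R.stable_set_def)
    have V': "V'_at p \<eta> y k = R.stable_closure (y \<oplus> Delta p (- k))" for k
      unfolding V'_at_def int_V
      by (subst closure_of_odometer) (use R.stable_set_B bdW_subset in \<open>auto simp: R.stable_closure_def\<close>)
    have gamma: "od_diff p y (Delta p k) = y \<oplus> Delta p (- k)" for k
      by (rule od_eqI, use y in simp, use y in simp,
          simp only: od_defs cong_def mod_simps, simp add: algebra_simps)
    have K: "k \<in> K_set p \<eta> y \<longleftrightarrow> R.stable_set (y \<oplus> Delta p (- k)) \<noteq> {}" for k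
      unfolding K_set_def int_V by simp
    have "k \<in> L" if "k \<in> K_set p \<eta> y" for k
      using R.stable_set_nonempty_imp[OF L(1) y cover, of "- k"] that L(2) unfolding K by blast
    moreover have "int_V_at p \<eta> y k \<inter> int_V_at p \<eta> y l = {}" if "k \<noteq> l" for k l
      unfolding int_V using R.stable_set_disjoint[OF L(1) y cover, of "- k" "- l"] that by simp
    moreover have "B = (\<Union>k\<in>K_set p \<eta> y. V'_at p \<eta> y k)"
    proof (intro equalityI subsetI)
      fix g assume "g \<in> B"
      then obtain l where l: "g \<in> R.stable_closure (y \<oplus> Delta p l)" using R.stable_closure_cover[OF L(1) y cover] by blast
      then have "R.stable_set (y \<oplus> Delta p l) \<noteq> {}" unfolding R.stable_closure_def by blast
      then have "- l \<in> K_set p \<eta> y" unfolding K by simp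
      moreover have "g \<in> V'_at p \<eta> y (- l)" unfolding V' using l by simp
      ultimately show "g \<in> (\<Union>k\<in>K_set p \<eta> y. V'_at p \<eta> y k)" by blast
    next
      fix g assume "g \<in> (\<Union>k\<in>K_set p \<eta> y. V'_at p \<eta> y k)"
      then show "g \<in> B" unfolding V' using R.stable_closure_B by blast
    qed
    moreover have "{v \<oplus> od_mult p j (od_diff p y (Delta p k)) |v j. v \<in> V'_at p \<eta> y k} \<subseteq> V'_at p \<eta> y k" for k
      unfolding V' gamma using R.stable_closure_mult[OF L(1) y cover] by blast
    ultimately show ?thesis unfolding L_def by blast
  qed
  show ?thesis
    by (rule conjI[OF _ conjI]; intro allI impI; (elim conjE)?;
        rule R.nowhere_dense_progression R.nowhere_dense_translate dynamics; assumption)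
qed

end
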